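(* Let $p\neq 2$ be a prime, let $n$ be a positive integer with $p\mid n$, and let $e\ge 1$ be an integer. Let $S_e$ be the number of integers $x$ with $1\le x\le p^e(p-1)$ and $p\nmid x$ such that $$x^{x^n}\equiv x\pmod{p^e}.$$ If $e\le v_p(n)$, then $$S_e=\left\{\sum_{x_0=1}^{p-1}\gcd(p-1,x_0^n-1)\right\}+\left\{\sum_{x_0=1}^{p-1}\gcd(p-1,n,x_0^n-1)\cdot\left(p^{e-1}-1\right)\right\}$$ $$=\left\{\sum_{d\mid p-1}\phi(d)\left(\frac{p-1}{d}\right)N_{x^n-1}(d)\right\}+\left\{\sum_{d\mid\gcd(n,p-1)}\phi(d)\left(\frac{p-1}{d}\right)N_{x^n-1}(d)\cdot\left(p^{e-1}-1\right)\right\}.$$ If $e\ge v_p(n)+1$, then $$S_e=\left\{\sum_{x_0=1}^{p-1}\gcd(p-1,x_0^n-1)\right\}+\left\{\sum_{x_0=1}^{p-1}\gcd(p-1,n,x_0^n-1)\cdot\left(p^{\lfloor (e+v_p(n))/2\rfloor}-1\right)\right\}$$ $$=\left\{\sum_{d\mid p-1}\phi(d)\left(\frac{p-1}{d}\right)N_{x^n-1}(d)\right\}+\left\{\sum_{d\mid\gcd(n,p-1)}\phi(d)\left(\frac{p-1}{d}\right)N_{x^n-1}(d)\cdot\left(p^{\lfloor (e+v_p(n))/2\rfloor}-1\right)\right\}.$$ In either case, the number of pairs $(x,x_0)\in\mathbb{Z}_p\times\{1,\dots,p-1\}$ with $p\nmid x$ satisfying $$\omega(x)^{x_0^n}\langle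 x\rangle^{x^n}=x$$ is only $$\sum_{x_0=1}^{p-1}\gcd(p-1,x_0^n-1)=\sum_{d\mid p-1}\phi(d)\left(\frac{p-1}{d}\right)N_{x^n-1}(d).$$
   Context: Here $p$ is an odd prime. $\mathbb{Z}_p$ is the ring of $p$-adic integers, $v_p$ the $p$-adic valuation, $\phi$ the Euler phi function. For $x\in\mathbb{Z}_p^\times$, $\omega(x)$ is the Teichmüller representative of $x$ (the unique $(p-1)$-th root of unity in $\mathbb{Z}_p$ congruent to $x$ modulo $p$), and $\langle x\rangle=x/\omega(x)\in 1+p\mathbb{Z}_p$; for $z\in\mathbb{Z}_p$, $\langle x\rangle^{z}=\exp(z\log\langle x\rangle)$. For a positive integer $d$, $N_{x^n-1}(d)$ is the number of $z\in\mathbb{Z}/d\mathbb{Z}$ with $z^n-1\equiv 0\pmod d$. Convention: $\gcd$ with $0$ as one argument ignores that argument, e.g. $\gcd(m,0)=m$. *)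

theory Defs
  imports "HOL-Algebra.Divisibility" "HOL-Number_Theory.Number_Theory"
begin

(* The ring of p-adic integers as the inverse limit of the rings Z/p^m: an element is a
   compatible sequence of residues, f m being the representative in {0..<p^m}. *)
definition Zp :: "nat \<Rightarrow> (nat \<Rightarrow> int) ring" where
  "Zp p = \<lparr>carrier = {f. \<forall>m. 0 \<le> f m \<and> f m < int p ^ m \<and> f (Suc m) mod int p ^ m = f m},
           mult = (\<lambda>f g m. f m * g m mod int p ^ m),
           one = (\<lambda>m. 1 mod int p ^ m),
           zero = (\<lambda>m. 0),
           add = (\<lambda>f g m. (f m + g m) mod int p ^ m)\<rparr>"

lemma Zp_cring:
  assumes "p > 0"
  shows "cring (Zp p)"
proof (rule cringI)
  have pos: "int p ^ m > 0" for m
    using assms by simp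
  have red: "a mod int p ^ Suc m mod int p ^ m = a mod int p ^ m" for a m
    by (rule mod_mod_cancel) simp
  have small: "f m mod int p ^ m = f m" if "f \<in> carrier (Zp p)" for f m
    using that by (simp add: Zp_def)
  have closed: "(\<lambda>m. h m mod int p ^ m) \<in> carrier (Zp p)"
    if "\<And>m. h (Suc m) mod int p ^ m = h m mod int p ^ m" for h
    using that pos by (simp add: Zp_def red del: power_Suc)
  have step: "f (Suc m) mod int p ^ m = f m mod int p ^ m" if "f \<in> carrier (Zp p)" for f m
    using that by (simp add: Zp_def)
  have mult_closed: "x \<otimes>\<^bsub>Zp p\<^esub> y \<in> carrier (Zp p)"
    if "x \<in> carrier (Zp p)" "y \<in> carrier (Zp p)" for x y
    using closed[of "\<lambda>m. x m * y m"] mod_mult_cong[OF step[OF that(1)] step[OF that(2)]]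
    by (simp add: Zp_def)
  have add_closed: "x \<oplus>\<^bsub>Zp p\<^esub> y \<in> carrier (Zp p)"
    if "x \<in> carrier (Zp p)" "y \<in> carrier (Zp p)" for x y
    using closed[of "\<lambda>m. x m + y m"] mod_add_cong[OF step[OF that(1)] step[OF that(2)]]
    by (simp add: Zp_def)
  show "abelian_group (Zp p)"
  proof (rule abelian_groupI)
    fix x assume x: "x \<in> carrier (Zp p)"
    have "(\<lambda>m. (- x m) mod int p ^ m) \<in> carrier (Zp p)"
      by (rule closed) (rule mod_minus_cong[OF step[OF x]])
    moreover have "(\<lambda>m. (- x m) mod int p ^ m) \<oplus>\<^bsub>Zp p\<^esub> x = \<zero>\<^bsub>Zp p\<^esub>"
      by (simp add: Zp_def fun_eq_iff mod_simps)
    ultimately show "\<exists>y\<in>carrier (Zp p). y \<oplus>\<^bsub>Zp p\<^esub> x = \<zero>\<^bsub>Zp p\<^esub>"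
      by blast
  next
    fix x assume "x \<in> carrier (Zp p)"
    then show "\<zero>\<^bsub>Zp p\<^esub> \<oplus>\<^bsub>Zp p\<^esub> x = x"
      using small by (simp add: Zp_def)
  next
    show "\<zero>\<^bsub>Zp p\<^esub> \<in> carrier (Zp p)"
      using pos by (simp add: Zp_def)
  qed (simp_all add: add_closed, simp_all add: Zp_def mod_simps add.assoc add.commute add.left_commute)
  show "comm_monoid (Zp p)"
  proof (rule comm_monoidI)
    show "\<one>\<^bsub>Zp p\<^esub> \<in> carrier (Zp p)"
      using closed[of "\<lambda>m. 1"] by (simp add: Zp_def)
  next
    fix x assume "x \<in> carrier (Zp p)"
    then show "\<one>\<^bsub>Zp p\<^esub> \<otimes>\<^bsub>Zp p\<^esub> x = x"
      using small by (simp add: Zp_def mod_simps)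
  qed (simp_all add: mult_closed, simp_all add: Zp_def mod_simps mult.assoc mult.commute mult.left_commute)
  show "(x \<oplus>\<^bsub>Zp p\<^esub> y) \<otimes>\<^bsub>Zp p\<^esub> z = x \<otimes>\<^bsub>Zp p\<^esub> z \<oplus>\<^bsub>Zp p\<^esub> y \<otimes>\<^bsub>Zp p\<^esub> z"
    for x y z
    by (simp add: Zp_def mod_simps distrib_right)
qed

definition Zp_of_nat :: "nat \<Rightarrow> nat \<Rightarrow> (nat \<Rightarrow> int)" where
  "Zp_of_nat p k = [k] \<cdot>\<^bsub>Zp p\<^esub> \<one>\<^bsub>Zp p\<^esub>"

definition Zp_tendsto :: "nat \<Rightarrow> (nat \<Rightarrow> (nat \<Rightarrow> int)) \<Rightarrow> (nat \<Rightarrow> int) \<Rightarrow> bool" where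
  "Zp_tendsto p s l \<longleftrightarrow>
     (\<forall>m::nat. \<forall>\<^sub>F i in sequentially. (Zp_of_nat p p [^]\<^bsub>Zp p\<^esub> m) divides\<^bsub>Zp p\<^esub> (s i \<ominus>\<^bsub>Zp p\<^esub> l))"

definition Zp_suminf :: "nat \<Rightarrow> (nat \<Rightarrow> (nat \<Rightarrow> int)) \<Rightarrow> (nat \<Rightarrow> int)" where
  "Zp_suminf p f = (THE l. l \<in> carrier (Zp p) \<and>
     Zp_tendsto p (\<lambda>N. \<Oplus>\<^bsub>Zp p\<^esub>i\<in>{..<N}. f i) l)"

(* The quotient a / k in the field of p-adic numbers, provided that it lies in Z_p. This is
   the case for all terms of the two series below when u - 1 and y are in p Z_p and p is odd. *)
definition Zp_div_nat :: "nat \<Rightarrow> (nat \<Rightarrow> int) \<Rightarrow> nat \<Rightarrow> (nat \<Rightarrow> int)" where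
  "Zp_div_nat p a k = (THE c. c \<in> carrier (Zp p) \<and> Zp_of_nat p k \<otimes>\<^bsub>Zp p\<^esub> c = a)"

(* log u = (SUM k. (-1)^k (u - 1)^(k+1) / (k+1)), for u in 1 + p Z_p *)
definition Zp_log :: "nat \<Rightarrow> (nat \<Rightarrow> int) \<Rightarrow> (nat \<Rightarrow> int)" where
  "Zp_log p u = Zp_suminf p (\<lambda>k. Zp_div_nat p
     ((\<ominus>\<^bsub>Zp p\<^esub> \<one>\<^bsub>Zp p\<^esub>) [^]\<^bsub>Zp p\<^esub> k \<otimes>\<^bsub>Zp p\<^esub> (u \<ominus>\<^bsub>Zp p\<^esub> \<one>\<^bsub>Zp p\<^esub>) [^]\<^bsub>Zp p\<^esub> Suc k) (Suc k))"

(* exp y = (SUM k. y^k / k!), for y in p Z_p *)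
definition Zp_exp :: "nat \<Rightarrow> (nat \<Rightarrow> int) \<Rightarrow> (nat \<Rightarrow> int)" where
  "Zp_exp p y = Zp_suminf p (\<lambda>k. Zp_div_nat p (y [^]\<^bsub>Zp p\<^esub> k) (fact k))"

definition teichmuller :: "nat \<Rightarrow> (nat \<Rightarrow> int) \<Rightarrow> (nat \<Rightarrow> int)" where
  "teichmuller p x = (THE w. w \<in> carrier (Zp p) \<and> w [^]\<^bsub>Zp p\<^esub> (p - 1) = \<one>\<^bsub>Zp p\<^esub> \<and>
     Zp_of_nat p p divides\<^bsub>Zp p\<^esub> (w \<ominus>\<^bsub>Zp p\<^esub> x))"

definition one_unit_part :: "nat \<Rightarrow> (nat \<Rightarrow> int) \<Rightarrow> (nat \<Rightarrow> int)" where
  "one_unit_part p x = x \<otimes>\<^bsub>Zp p\<^esub> inv\<^bsub>Zp p\<^esub> (teichmuller p x)"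

(* u^z for u in 1 + p Z_p and z in Z_p *)
definition Zp_powr :: "nat \<Rightarrow> (nat \<Rightarrow> int) \<Rightarrow> (nat \<Rightarrow> int) \<Rightarrow> (nat \<Rightarrow> int)" where
  "Zp_powr p u z = Zp_exp p (z \<otimes>\<^bsub>Zp p\<^esub> Zp_log p u)"

(* the solutions of omega(x)^(x0^n) <x>^(x^n) = x *)
definition Zp_solutions :: "nat \<Rightarrow> nat \<Rightarrow> ((nat \<Rightarrow> int) \<times> nat) set" where
  "Zp_solutions p n = {(x, x0). x \<in> carrier (Zp p) \<and> x0 \<in> {1..p - 1} \<and>
     \<not> Zp_of_nat p p divides\<^bsub>Zp p\<^esub> x \<and>
     teichmuller p x [^]\<^bsub>Zp p\<^esub> (x0 ^ n) \<otimes>\<^bsub>Zp p\<^esub>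
       Zp_powr p (one_unit_part p x) (x [^]\<^bsub>Zp p\<^esub> n) = x}"

definition num_sols :: "nat \<Rightarrow> nat \<Rightarrow> nat \<Rightarrow> nat" where
  "num_sols p n e = card {x \<in> {1..p ^ e * (p - 1)}. \<not> p dvd x \<and> [x ^ (x ^ n) = x] (mod p ^ e)}"

(* the number of zeros of z^n - 1 in Z/d, counted on the representatives 0, ..., d - 1 *)
definition N_roots :: "nat \<Rightarrow> nat \<Rightarrow> nat" where
  "N_roots n d = card {z \<in> {0..<int d}. [z ^ n - 1 = 0] (mod int d)}"

end

theory Submission
  imports Defs
begin

text \<open>
  Every unit modulo a power of \<open>p\<close>, and every unit of the \<open>p\<close>-adic integers, is a root of unity of
  order dividing \<open>p - 1\<close> times a one-unit, that is, an element congruent to \<open>1\<close> modulo \<open>p\<close>. Both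
  counts come from solving the equation in the two factors separately.

  For the integer congruence, cancel \<open>x\<close> to get \<open>x ^ (x ^ n - 1) = 1\<close> modulo \<open>p ^ e\<close>. On the root of
  unity the exponent matters only modulo \<open>p - 1\<close>, so that it may be replaced by \<open>x0 ^ n - 1\<close> with
  \<open>x0 = x mod (p - 1)\<close>. The one-unit is controlled through \<open>x ^ (p - 1)\<close>: by lifting the exponent
  (\<open>lifting_the_exponent\<close>), \<open>p ^ e\<close> has to divide \<open>(x ^ n - 1) * (x ^ (p - 1) - 1)\<close>. If \<open>x ^ n\<close> is not
  \<open>1\<close> modulo \<open>p\<close>, the first factor is a unit, and \<open>x\<close> must be a root of unity modulo \<open>p ^ e\<close>. If
  \<open>x ^ n\<close> is \<open>1\<close> modulo \<open>p\<close>, the two factors have valuations \<open>j + v\<close> and \<open>j\<close>, where \<open>v\<close> is the valuation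
  of \<open>n\<close>, and the condition becomes \<open>2 * j + v \<ge> e\<close> (or \<open>j \<ge> e\<close>). In both cases \<open>x\<close> is a root of unity
  modulo some \<open>p ^ J\<close>, so the Chinese remainder theorem leaves \<open>p ^ (e - J)\<close> integers for each \<open>x0\<close>
  and each admissible residue of \<open>x\<close> modulo \<open>p\<close> (\<open>num_sols_eq\<close>). Cyclicity of the unit group modulo
  \<open>p\<close> turns the numbers of admissible residues into greatest common divisors, and expanding these
  by \<open>k = (\<Sum>d | d dvd k. totient d)\<close> gives the sums over divisors.

  For the \<open>p\<close>-adic equation, write \<open>x = w * u\<close> with \<open>w\<close> a root of unity and \<open>u\<close> a one-unit, and put
  \<open>z = x ^ n\<close>. It splits into \<open>w ^ (x0 ^ n) = w\<close> and \<open>exp (z * log u) = u\<close>. The two series enter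
  through the congruences, for \<open>q = p ^ m\<close>,
  \<open>exp y ^ q = 1 + q * y\<close> and \<open>u ^ q = 1 + q * log u\<close> modulo \<open>q ^ 2\<close>
  (\<open>Zp_exp_cong\<close> and \<open>Zp_log_cong\<close>): raising the second equation to the power \<open>q\<close> shows that
  \<open>z * log u\<close> and \<open>log u\<close> agree modulo every \<open>q\<close>, so that \<open>log u = 0\<close> or \<open>z = 1\<close>. The first gives \<open>u = 1\<close>,
  and so does the second, because one-units have no torsion. The solutions
  are therefore exactly the roots of unity with \<open>w ^ (x0 ^ n) = w\<close> (\<open>Zp_solutions_eq\<close>); they
  correspond to their residues modulo \<open>p\<close>, and this makes the count the first sum of the integer
  case.
\<close>

section \<open>Powers modulo prime powers\<close>

lemma cong_power_prime_step:
  fixes a b :: int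
  assumes "[a = b] (mod int p ^ m)" and "m \<ge> 1"
  shows "[a ^ p = b ^ p] (mod int p ^ Suc m)"
proof -
  have ab: "[a = b] (mod int p)"
    using assms by (metis cong_dvd_modulus dvd_power less_le_trans zero_less_one)
  \<comment> \<open>The cofactor of \<open>a - b\<close> in \<open>a ^ p - b ^ p\<close> is \<open>p * b ^ (p - 1)\<close> modulo \<open>p\<close>, hence \<open>0\<close>.\<close>
  have "[(\<Sum>i<p. a ^ (p - Suc i) * b ^ i) = (\<Sum>i<p. b ^ (p - 1))] (mod int p)"
  proof (rule cong_sum)
    fix i assume "i \<in> {..<p}"
    then have "b ^ (p - 1) = b ^ (p - Suc i) * b ^ i"
      by (simp flip: power_add)
    then show "[a ^ (p - Suc i) * b ^ i = b ^ (p - 1)] (mod int p)"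
      using ab by (auto intro: cong_mult cong_pow)
  qed
  then have "int p dvd (\<Sum>i<p. a ^ (p - Suc i) * b ^ i)"
    by (simp add: cong_def mod_eq_0_iff_dvd)
  moreover have "int p ^ m dvd a - b"
    using assms(1) by (simp add: cong_iff_dvd_diff)
  ultimately have "int p ^ m * int p dvd (a - b) * (\<Sum>i<p. a ^ (p - Suc i) * b ^ i)"
    by (rule mult_dvd_mono[rotated])
  then show ?thesis
    unfolding cong_iff_dvd_diff power_diff_sumr2[of a p b]
    by (subst (asm) sum.nat_diff_reindex[symmetric]) (simp add: mult.commute)
qed

text \<open>Raising to the power \<open>p\<close> gains one factor \<open>p\<close> in a congruence. In particular the sequence
  \<open>a ^ p ^ m\<close> depends, modulo growing powers of \<open>p\<close>, only on \<open>a\<close> modulo \<open>p\<close>; this is what makes it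
  converge to the Teichmueller representative of \<open>a\<close>.\<close>

lemma cong_power_prime_power:
  fixes a b :: int
  assumes "[a = b] (mod int p)"
  shows "[a ^ (p ^ m) = b ^ (p ^ m)] (mod int p ^ Suc m)"
proof (induction m)
  case 0
  then show ?case using assms by simp
next
  case (Suc m)
  then have "[(a ^ p ^ m) ^ p = (b ^ p ^ m) ^ p] (mod int p ^ Suc (Suc m))"
    by (intro cong_power_prime_step) auto
  then show ?case
    by (simp flip: power_mult add: mult.commute)
qed

text \<open>Together with \<open>cong_power_prime_power\<close> this shows that a root of unity modulo a power of \<open>p\<close> is
  determined by its residue modulo \<open>p\<close>.\<close>

lemma power_prime_power_fixed:
  fixes x :: "'a::unique_euclidean_semiring"
  assumes "[x ^ (p - 1) = 1] (mod M)" and "p > 0"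
  shows "[x ^ p ^ k = x] (mod M)"
proof (induction k)
  case (Suc k)
  have "[(x ^ p ^ k) ^ p = x ^ p] (mod M)"
    using Suc by (rule cong_pow)
  also have "x ^ p = x ^ (p - 1) * x"
    using assms(2) by (metis Suc_diff_1 power_Suc2)
  also have "[\<dots> = 1 * x] (mod M)"
    using assms(1) by (rule cong_mult) simp
  finally show ?case by (simp add: mult.commute flip: power_mult)
qed simp

lemma int_fermat:
  assumes p: "prime p" and a: "\<not> int p dvd a"
  shows "[a ^ (p - 1) = 1] (mod int p)"
proof -
  define b where "b = nat (a mod int p)"
  have b: "[int b = a] (mod int p)"
    using prime_gt_0_nat[OF p] by (simp add: b_def)
  then have "\<not> p dvd b" using a by (metis cong_dvd_iff int_dvd_int_iff)
  then have "[b ^ (p - 1) = 1] (mod p)" using p by (intro fermat_theorem)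
  then have "[int b ^ (p - 1) = 1] (mod int p)" by (metis cong_int_iff of_nat_1 of_nat_power)
  then show ?thesis using cong_pow[OF b, of "p - 1"] by (meson cong_sym cong_trans)
qed

lemma sum_lessThan_odd_dvd:
  assumes "odd p"
  shows "int p dvd (\<Sum>i<p. int i)"
proof -
  have "2 * (\<Sum>i<p. int i) = int p * (int p - 1)"
    by (induction p) (auto simp: algebra_simps)
  then have "int p dvd 2 * (\<Sum>i<p. int i)" by simp
  moreover have "coprime (int p) 2"
    using assms by (simp add: coprime_commute)
  ultimately show ?thesis
    using coprime_dvd_mult_right_iff by blast
qed

text \<open>Stated as an equivalence of divisibilities, the lemma makes sense also if one side is zero, and
  it composes: if it holds for two exponents, it holds for their product. Hence only exponents prime
  to \<open>p\<close>, where \<open>(a ^ k - 1) / (a - 1)\<close> is congruent to \<open>k\<close> and so a unit, and the exponent \<open>p\<close> have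
  to be treated. For the latter \<open>(a ^ p - 1) / (a - 1)\<close> is \<open>p\<close> modulo \<open>p\<^sup>2\<close>; here \<open>p\<close> must be odd for
  \<open>0 + 1 + \<dots> + (p - 1)\<close> to be divisible by \<open>p\<close>.\<close>

lemma lifting_the_exponent:
  fixes a :: int
  assumes p: "prime p" "p \<noteq> 2" and a: "[a = 1] (mod int p)"
  shows "int p ^ M dvd a ^ k - 1 \<longleftrightarrow> int p ^ M dvd int k * (a - 1)"
  using a
proof (induction k arbitrary: a rule: less_induct)
  case (less k)
  have geo: "a ^ k - 1 = (a - 1) * (\<Sum>i<k. a ^ i)" for k
    by (rule power_diff_1_eq)
  consider "k = 0" | "\<not> p dvd k" | k' where "k = p * k'" "k' < k" "k \<noteq> 0"
  proof (cases "k = 0 \<or> \<not> p dvd k")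
    case False
    then obtain k' where "k = p * k'" "k \<noteq> 0" by auto
    moreover from this have "k' < k"
      using prime_gt_1_nat[OF p(1)] by simp
    ultimately show ?thesis using that by blast
  qed (use that in blast)
  then show ?case
  proof cases
    case 1
    then show ?thesis by simp
  next
    case 2
    have "[(\<Sum>i<k. a ^ i) = (\<Sum>i<k. 1)] (mod int p)"
      using less.prems by (intro cong_sum) (metis cong_pow power_one)
    then have "\<not> int p dvd (\<Sum>i<k. a ^ i)"
      using 2 by (simp add: cong_dvd_iff)
    then have "coprime (int p ^ M) (\<Sum>i<k. a ^ i)" "coprime (int p ^ M) (int k)"
      using p(1) 2 by (auto intro!: coprime_power_left_iff[THEN iffD2] prime_imp_coprime)
    then show ?thesis
      by (simp add: geo coprime_dvd_mult_left_iff coprime_dvd_mult_right_iff)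
  next
    case (3 k')
    obtain t where t: "a = 1 + int p * t"
      using less.prems by (metis cong_iff_lin cong_sym mult.commute)
    have "[(\<Sum>i<p. a ^ i) = (\<Sum>i<p. 1 + int i * (int p * t))] (mod int p ^ 2)"
    proof (rule cong_sum)
      fix i
      show "[a ^ i = 1 + int i * (int p * t)] (mod int p ^ 2)"
      proof (induction i)
        case (Suc i)
        have "[a * a ^ i = (1 + int p * t) * (1 + int i * (int p * t))] (mod int p ^ 2)"
          unfolding t using Suc t by (intro cong_mult) auto
        also have "(1 + int p * t) * (1 + int i * (int p * t))
            = (1 + int (Suc i) * (int p * t)) + int p ^ 2 * (int i * t ^ 2)"
          by (simp add: algebra_simps power2_eq_square)
        also have "[\<dots> = 1 + int (Suc i) * (int p * t)] (mod int p ^ 2)"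
          by (simp add: cong_def)
        finally show ?case by simp
      qed simp
    qed
    also have "(\<Sum>i<p. 1 + int i * (int p * t)) = int p + (\<Sum>i<p. int i) * (int p * t)"
      by (simp add: sum.distrib sum_distrib_right)
    also have "[\<dots> = int p] (mod int p ^ 2)"
      using sum_lessThan_odd_dvd[of p] prime_odd_nat[OF p(1)] p prime_ge_2_nat[OF p(1)]
      by (auto simp: cong_iff_dvd_diff power2_eq_square intro!: mult_dvd_mono)
    finally have "int p ^ 2 dvd (\<Sum>i<p. a ^ i) - int p"
      by (simp add: cong_iff_dvd_diff)
    then obtain s where "(\<Sum>i<p. a ^ i) - int p = int p ^ 2 * s" ..
    then have s: "(\<Sum>i<p. a ^ i) = int p * (1 + int p * s)"
      by (simp add: algebra_simps power2_eq_square)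
    have "coprime (int p) (1 + int p * s)"
      by (metis coprime_1_right coprime_iff_gcd_eq_1 gcd_add_mult mult.commute add.commute)
    then have cop: "coprime (int p ^ M) (1 + int p * s)"
      by simp
    have "[a ^ p = 1] (mod int p)"
      using cong_pow[OF less.prems, of p] by simp
    then have "int p ^ M dvd (a ^ p) ^ k' - 1 \<longleftrightarrow> int p ^ M dvd int k' * (a ^ p - 1)"
      using less.IH 3 by blast
    also have "int k' * (a ^ p - 1) = (int k * (a - 1)) * (1 + int p * s)"
      unfolding geo s by (simp add: 3)
    also have "int p ^ M dvd \<dots> \<longleftrightarrow> int p ^ M dvd int k * (a - 1)"
      using cop by (simp add: coprime_dvd_mult_left_iff)
    finally show ?thesis
      by (simp add: 3 power_mult)
  qed
qed

lemma multiplicity_of_nat_int: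
  assumes "prime p"
  shows "multiplicity (int p) (int k) = multiplicity p k"
proof (cases "k = 0")
  case False
  have "\<not> is_unit p" "\<not> is_unit (int p)"
    using assms by auto
  then have "M \<le> multiplicity (int p) (int k) \<longleftrightarrow> M \<le> multiplicity p k" for M
    using False by (simp flip: power_dvd_iff_le_multiplicity of_nat_power)
  then show ?thesis
    by (metis le_antisym order_refl)
qed simp

corollary multiplicity_power_minus_one:
  fixes a :: int
  assumes p: "prime p" "p \<noteq> 2" and a: "[a = 1] (mod int p)" "a ^ k \<noteq> 1"
  shows "multiplicity (int p) (a ^ k - 1) = multiplicity p k + multiplicity (int p) (a - 1)"
proof -
  have nz: "k \<noteq> 0" "a \<noteq> 1"
    using a(2) by (auto intro: gr0I)
  have "\<not> is_unit (int p)"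
    using p(1) by auto
  then have "M \<le> multiplicity (int p) (a ^ k - 1) \<longleftrightarrow> M \<le> multiplicity (int p) (int k * (a - 1))" for M
    using lifting_the_exponent[OF p a(1), of M k] a(2) nz by (simp add: power_dvd_iff_le_multiplicity)
  then have "multiplicity (int p) (a ^ k - 1) = multiplicity (int p) (int k * (a - 1))"
    by (metis le_antisym order_refl)
  also have "\<dots> = multiplicity (int p) (int k) + multiplicity (int p) (a - 1)"
    using p(1) nz by (intro prime_elem_multiplicity_mult_distrib) auto
  finally show ?thesis
    by (simp add: multiplicity_of_nat_int[OF p(1)])
qed

section \<open>Counting residues\<close>

lemma card_cong_atLeastAtMost:
  fixes M k c :: nat
  assumes "M > 0"
  shows "card {x \<in> {1..M * k}. [x = c] (mod M)} = k"
proof -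
  define r where "r = (c + (M - 1)) mod M"
  have r: "r < M" "[Suc r = c] (mod M)"
  proof -
    show "r < M" using assms by (simp add: r_def)
    have "[Suc r = c + M] (mod M)"
      using assms by (auto simp: cong_def r_def mod_Suc_eq)
    then show "[Suc r = c] (mod M)" by (simp add: cong_def)
  qed
  have "bij_betw (\<lambda>i. Suc (M * i + r)) {..<k} {x \<in> {1..M * k}. [x = c] (mod M)}"
  proof (rule bij_betw_byWitness[where f' = "\<lambda>x. (x - 1) div M"])
    show "\<forall>i\<in>{..<k}. (Suc (M * i + r) - 1) div M = i"
      using r by auto
    show "(\<lambda>i. Suc (M * i + r)) ` {..<k} \<subseteq> {x \<in> {1..M * k}. [x = c] (mod M)}"
    proof (safe; simp)
      fix i assume "i < k"
      then have "M * Suc i \<le> M * k" by (intro mult_left_mono) auto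
      then show "Suc (M * i + r) \<le> M * k" using r by simp
      show "[Suc (M * i + r) = c] (mod M)"
        using r(2) by (metis cong_def add_Suc_right mod_mult_self4)
    qed
    show "(\<lambda>x. (x - 1) div M) ` {x \<in> {1..M * k}. [x = c] (mod M)} \<subseteq> {..<k}"
      using assms by (auto simp: less_mult_imp_div_less mult.commute)
    show "\<forall>x\<in>{x \<in> {1..M * k}. [x = c] (mod M)}. Suc (M * ((x - 1) div M) + r) = x"
    proof safe
      fix x assume x: "x \<in> {1..M * k}" "[x = c] (mod M)"
      then have "[Suc (x - 1) = Suc r] (mod M)"
        using r(2) by (auto simp: cong_def)
      then have "[x - 1 = r] (mod M)"
        using cong_add_rcancel_nat[of "x - 1" 1 r M] by simp
      then have "(x - 1) mod M = r" using r(1) by (simp add: cong_def)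
      then show "Suc (M * ((x - 1) div M) + r) = x"
        using x mult_div_mod_eq[of M "x - 1"] by simp
    qed
  qed
  then show ?thesis
    using bij_betw_same_card by fastforce
qed

text \<open>The nonzero residues are the powers \<open>g ^ i\<close> of a primitive root with \<open>i < p - 1\<close>, and
  \<open>g ^ (i * k) = 1\<close> holds if and only if \<open>(p - 1) div gcd (p - 1) k\<close> divides \<open>i\<close>.\<close>

lemma card_roots_of_unity_mod_prime:
  assumes "prime p"
  shows "card {a \<in> {1..p - 1}. [a ^ k = 1] (mod p)} = gcd (p - 1) k"
proof -
  obtain g where g: "residue_primroot p g"
    using prime_primitive_root_exists[of p] assms prime_gt_1_nat[of p] by auto
  then have ord: "ord p g = p - 1" "coprime p g"
    using assms by (auto simp: residue_primroot_def totient_prime)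
  have tot: "totatives p = {1..p - 1}"
    using assms by (auto simp: totatives_prime)
  have "bij_betw (\<lambda>i. g ^ i mod p) {..<p - 1} {1..p - 1}"
    using residue_primroot_is_generator[OF prime_gt_1_nat[OF assms] g]
    unfolding tot totient_prime[OF assms] .
  then have "bij_betw (\<lambda>i. g ^ i mod p) {i \<in> {..<p - 1}. [(g ^ i mod p) ^ k = 1] (mod p)}
      {a \<in> {1..p - 1}. [a ^ k = 1] (mod p)}"
    by (rule bij_betw_Collect) auto
  then have "card {a \<in> {1..p - 1}. [a ^ k = 1] (mod p)}
      = card {i \<in> {..<p - 1}. [(g ^ i mod p) ^ k = 1] (mod p)}"
    by (rule bij_betw_same_card[symmetric])
  also have "{i \<in> {..<p - 1}. [(g ^ i mod p) ^ k = 1] (mod p)} = {i \<in> {..<p - 1}. p - 1 dvd i * k}"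
  proof -
    have "[(g ^ i mod p) ^ k = 1] (mod p) \<longleftrightarrow> [g ^ (i * k) = 1] (mod p)" for i
      by (simp add: cong_def power_mod power_mult)
    then show ?thesis by (simp only: ord_divides ord(1))
  qed
  also have "\<dots> = (*) ((p - 1) div gcd (p - 1) k) ` {..<gcd (p - 1) k}"
  proof -
    have "p - 1 > 0" using assms prime_gt_1_nat[of p] by simp
    define d where "d = gcd (p - 1) k"
    have d: "d > 0" using \<open>p - 1 > 0\<close> by (simp add: d_def)
    define M where "M = (p - 1) div d"
    have M: "p - 1 = M * d" by (simp add: M_def d_def)
    obtain l where l: "k = l * d" unfolding d_def by (metis dvd_div_mult_self gcd_dvd2)
    have "gcd (d * M) (d * l) = d"
      using d_def M l by (metis mult.commute)
    then have "d * gcd M l = d"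
      by (simp only: gcd_mult_distrib_nat)
    then have "gcd M l = 1" using d by simp
    then have "coprime M l" by (rule gcd_eq_1_imp_coprime)
    then have "p - 1 dvd i * k \<longleftrightarrow> M dvd i" for i
      unfolding M l using d by (simp add: mult.assoc[symmetric] coprime_dvd_mult_left_iff)
    moreover have "M > 0" using \<open>p - 1 > 0\<close> M by (auto intro: gr0I)
    ultimately show ?thesis
      using \<open>p - 1 > 0\<close> M unfolding M_def[symmetric] d_def[symmetric] by (auto elim!: dvdE simp: image_iff)
  qed
  also have "card \<dots> = gcd (p - 1) k"
    using assms prime_gt_1_nat[of p] by (subst card_image) (auto simp: inj_on_def dvd_div_eq_0_iff)
  finally show ?thesis .
qed

text \<open>Write each greatest common divisor \<open>k\<close> as the sum of \<open>totient d\<close> over \<open>d dvd k\<close> and exchange the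
  sums: the zeros of \<open>x ^ n - 1\<close> modulo \<open>d\<close> are counted \<open>q div d\<close> times as \<open>x\<close> runs from \<open>1\<close> to \<open>q\<close>.\<close>

lemma sum_gcd_eq_sum_totient:
  assumes "m dvd q" and "q > 0"
  shows "(\<Sum>x = 1..q. gcd m (x ^ n - 1)) = (\<Sum>d | d dvd m. totient d * (q div d) * N_roots n d)"
proof -
  have m: "m > 0" using assms by (simp add: dvd_pos_nat)
  have "(\<Sum>x = 1..q. gcd m (x ^ n - 1)) = (\<Sum>x = 1..q. \<Sum>d | d dvd m \<and> d dvd x ^ n - 1. totient d)"
    by (intro sum.cong refl) (subst totient_divisor_sum[symmetric], simp)
  also have "\<dots> = (\<Sum>x = 1..q. \<Sum>d | d dvd m. if d dvd x ^ n - 1 then totient d else 0)"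
    using m by (intro sum.cong refl sum.mono_neutral_cong_left) auto
  also have "\<dots> = (\<Sum>d | d dvd m. \<Sum>x = 1..q. if d dvd x ^ n - 1 then totient d else 0)"
    by (rule sum.swap)
  also have "\<dots> = (\<Sum>d | d dvd m. totient d * (q div d) * N_roots n d)"
  proof (rule sum.cong[OF refl])
    fix d assume "d \<in> {d. d dvd m}"
    then have d: "d dvd m" "d > 0" and q: "q = d * (q div d)"
      using m assms by (auto dest: dvd_pos_nat)
    define R where "R = {z \<in> {..<d}. [z ^ n = 1] (mod d)}"
    have "bij_betw int R {z \<in> {0..<int d}. [z ^ n - 1 = 0] (mod int d)}"
    proof (rule bij_betw_byWitness[where f' = nat])
      have *: "[int z ^ n - 1 = 0] (mod int d) \<longleftrightarrow> [z ^ n = 1] (mod d)" for z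
        using cong_int_iff[of "z ^ n" 1 d] by (simp add: cong_iff_dvd_diff)
      show "int ` R \<subseteq> {z \<in> {0..<int d}. [z ^ n - 1 = 0] (mod int d)}"
        using * by (auto simp: R_def)
      show "nat ` {z \<in> {0..<int d}. [z ^ n - 1 = 0] (mod int d)} \<subseteq> R"
      proof safe
        fix z assume "z \<in> {0..<int d}" "[z ^ n - 1 = 0] (mod int d)"
        then show "nat z \<in> R" using *[of "nat z"] by (auto simp: R_def nat_less_iff)
      qed
    qed auto
    then have R: "card R = N_roots n d"
      unfolding N_roots_def by (rule bij_betw_same_card)
    have "d dvd x ^ n - 1 \<longleftrightarrow> x mod d \<in> R" if "x \<in> {1..q}" for x
    proof -
      have "x ^ n \<ge> 1" using that by simp
      then have "d dvd x ^ n - 1 \<longleftrightarrow> [x ^ n = 1] (mod d)"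
        by (rule cong_altdef_nat[symmetric])
      then show ?thesis
        using d by (simp add: R_def cong_def power_mod)
    qed
    then have "(\<Sum>x = 1..q. if d dvd x ^ n - 1 then totient d else 0)
        = totient d * card {x \<in> {1..q}. x mod d \<in> R}"
      by (simp add: sum.If_cases Int_def conj_commute cong: conj_cong)
    also have "{x \<in> {1..q}. x mod d \<in> R} = (\<Union>r\<in>R. {x \<in> {1..d * (q div d)}. [x = r] (mod d)})"
      unfolding q[symmetric] by (auto simp: R_def cong_def)
    also have "card \<dots> = (\<Sum>r\<in>R. card {x \<in> {1..d * (q div d)}. [x = r] (mod d)})"
      by (rule card_UN_disjoint) (auto simp: R_def cong_def)
    also have "\<dots> = (q div d) * N_roots n d"
      using d by (subst card_cong_atLeastAtMost) (simp_all flip: R)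
    finally show "(\<Sum>x = 1..q. if d dvd x ^ n - 1 then totient d else 0)
        = totient d * (q div d) * N_roots n d"
      by simp
  qed
  finally show ?thesis .
qed

text \<open>The last two conditions say that \<open>x\<close> is congruent modulo \<open>p ^ J\<close> to \<open>a ^ p ^ (J - 1)\<close>, the root of
  unity above \<open>a\<close>. With the first condition this is a single residue class modulo
  \<open>p ^ J * (p - 1)\<close>.\<close>

lemma card_teichmuller_class:
  assumes p: "prime p" and J: "1 \<le> J" "J \<le> e" and a: "a \<in> {1..p - 1}"
  shows "card {x \<in> {1..p ^ e * (p - 1)}. [x = x0] (mod p - 1) \<and> [x = a] (mod p) \<and>
           [x ^ (p - 1) = 1] (mod p ^ J)} = p ^ (e - J)"
proof -
  obtain k where k: "J = Suc k" using J(1) by (cases J) auto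
  have lift: "[x ^ p ^ k = y ^ p ^ k] (mod p ^ J)" if "[x = y] (mod p)" for x y
    using cong_power_prime_power[of "int x" "int y" p k] that unfolding k
    by (metis cong_int_iff of_nat_power)
  have p1: "p > 1" using p by (rule prime_gt_1_nat)
  have "\<not> p dvd a" using a by (auto dest: dvd_imp_le)
  then have cop: "coprime a p"
    using p by (metis coprime_commute prime_imp_coprime)
  have root: "[x ^ (p - 1) = 1] (mod p ^ J) \<longleftrightarrow> [x = a ^ p ^ k] (mod p ^ J)" if "[x = a] (mod p)" for x
  proof
    assume x: "[x ^ (p - 1) = 1] (mod p ^ J)"
    have "[x ^ p ^ k = x] (mod p ^ J)"
      using x p1 by (intro power_prime_power_fixed) auto
    then show "[x = a ^ p ^ k] (mod p ^ J)"
      using lift[OF that] by (metis cong_sym cong_trans)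
  next
    assume "[x = a ^ p ^ k] (mod p ^ J)"
    then have "[x ^ (p - 1) = (a ^ p ^ k) ^ (p - 1)] (mod p ^ J)"
      by (rule cong_pow)
    also have "(a ^ p ^ k) ^ (p - 1) = a ^ totient (p ^ J)"
      using totient_prime_power_Suc[OF p, of k] by (simp add: k flip: power_mult)
    also have "[\<dots> = 1] (mod p ^ J)"
      using cop by (intro euler_theorem) simp
    finally show "[x ^ (p - 1) = 1] (mod p ^ J)" .
  qed
  have aa: "[a ^ p ^ k = a] (mod p)"
    using fermat_theorem[OF p \<open>\<not> p dvd a\<close>] p1 by (intro power_prime_power_fixed) auto
  have "coprime p (p - 1)"
    using p1 coprime_diff_one_right_nat by auto
  then have cop': "coprime (p ^ J) (p - 1)" by simp
  obtain c where c: "[c = a ^ p ^ k] (mod p ^ J)" "[c = x0] (mod p - 1)"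
    using binary_chinese_remainder_nat[OF cop'] by blast
  have "([x = x0] (mod p - 1) \<and> [x = a] (mod p) \<and> [x ^ (p - 1) = 1] (mod p ^ J))
      \<longleftrightarrow> [x = c] (mod p ^ J * (p - 1))" for x
  proof -
    have "[x = c] (mod p ^ J * (p - 1)) \<longleftrightarrow> [x = c] (mod p ^ J) \<and> [x = c] (mod p - 1)"
      using cop' coprime_cong_mult_nat[of x c "p ^ J" "p - 1"]
      by (auto intro: cong_dvd_modulus_nat)
    also have "\<dots> \<longleftrightarrow> [x = a ^ p ^ k] (mod p ^ J) \<and> [x = x0] (mod p - 1)"
      using c by (meson cong_sym cong_trans)
    also have "[x = a ^ p ^ k] (mod p ^ J) \<longleftrightarrow> [x = a] (mod p) \<and> [x = a ^ p ^ k] (mod p ^ J)"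
    proof -
      have "[x = a] (mod p)" if "[x = a ^ p ^ k] (mod p ^ J)"
        using cong_dvd_modulus_nat[OF that, of p] aa k by (auto intro: cong_trans)
      then show ?thesis by blast
    qed
    finally show ?thesis using root by blast
  qed
  note sys = this
  have size: "p ^ e * (p - 1) = (p ^ J * (p - 1)) * p ^ (e - J)"
    using J(2) by (simp add: mult_ac flip: power_add)
  show ?thesis
    unfolding sys size using p1 by (intro card_cong_atLeastAtMost) simp
qed

section \<open>The integer congruence\<close>

text \<open>The group of units modulo \<open>p ^ e\<close> has order \<open>p ^ (e - 1) * (p - 1)\<close>. The first condition on the
  right says that \<open>x ^ N\<close> has order a power of \<open>p\<close>, the second that its order divides \<open>p - 1\<close>.\<close>

lemma cong_1_mod_prime_power_iff:
  assumes p: "prime p" and e: "e \<ge> 1"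
  shows "[x ^ N = 1] (mod p ^ e) \<longleftrightarrow> [x ^ N = 1] (mod p) \<and> [x ^ ((p - 1) * N) = 1] (mod p ^ e)"
proof safe
  assume x: "[x ^ N = 1] (mod p ^ e)"
  then show "[x ^ N = 1] (mod p)"
    by (rule cong_dvd_modulus_nat) (use e in simp)
  show "[x ^ ((p - 1) * N) = 1] (mod p ^ e)"
    using cong_pow[OF x, of "p - 1"] by (simp add: mult.commute flip: power_mult)
next
  assume x: "[x ^ N = 1] (mod p)" "[x ^ ((p - 1) * N) = 1] (mod p ^ e)"
  obtain k where k: "e = Suc k" using e by (cases e) auto
  have "[x ^ (p ^ k * N) = 1] (mod p ^ e)"
    using cong_power_prime_power[of "int (x ^ N)" 1 p k] x(1) cong_int_iff[of _ 1]
    unfolding k by (metis of_nat_1 of_nat_power power_mult power_one mult.commute)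
  then have "ord (p ^ e) (x ^ N) dvd p ^ k" "ord (p ^ e) (x ^ N) dvd p - 1"
    using x(2) by (simp_all add: ord_divides[symmetric] mult.commute flip: power_mult)
  moreover have "coprime (p ^ k) (p - 1)"
    using prime_gt_1_nat[OF p] coprime_diff_one_right_nat[of p] by simp
  ultimately have "ord (p ^ e) (x ^ N) = 1"
    by (metis coprime_common_divisor_nat)
  then show "[x ^ N = 1] (mod p ^ e)"
    using ord_divides[of "x ^ N" 1 "p ^ e"] by simp
qed

text \<open>The level \<open>J\<close> is the least \<open>j \<ge> 1\<close> with \<open>2 * j + v \<ge> e\<close>, where \<open>v\<close> is the multiplicity of \<open>p\<close> in \<open>n\<close>:
  it is the precision to which \<open>x\<close> has to be a root of unity if \<open>x ^ n\<close> is \<open>1\<close> modulo \<open>p\<close>.\<close>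

lemma power_power_self_cong_iff:
  assumes p: "prime p" "p \<noteq> 2" and n: "n > 0" and e: "e \<ge> 1"
    and x: "\<not> p dvd x" and x0: "x0 \<ge> 1" "[x = x0] (mod p - 1)"
  defines "J \<equiv> max 1 ((e - multiplicity p n + 1) div 2)"
  shows "[x ^ (x ^ n) = x] (mod p ^ e) \<longleftrightarrow> [x ^ (x0 ^ n - 1) = 1] (mod p) \<and>
    ([x ^ (p - 1) = 1] (mod p ^ e) \<or> [x ^ n = 1] (mod p) \<and> [x ^ (p - 1) = 1] (mod p ^ J))"
proof -
  have x_pos: "x > 0" using x by (auto intro: gr0I)
  have p1: "p > 1" using p(1) by (rule prime_gt_1_nat)
  have cop: "coprime x (p ^ k)" for k
    using x p(1) by (metis coprime_commute coprime_power_right_iff prime_imp_coprime)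
  define N where "N = x ^ n - 1"
  have N: "x ^ n = Suc N" using x_pos by (simp add: N_def)
  have step1: "[x ^ (x ^ n) = x] (mod p ^ e) \<longleftrightarrow> [x ^ N = 1] (mod p ^ e)"
    using cong_mult_lcancel_nat[OF cop, of "x ^ N" 1 e] N by simp
  have fermat: "[x ^ (p - 1) = 1] (mod p)"
    using p(1) x by (rule fermat_theorem)
  have "[x ^ N = 1] (mod p) \<longleftrightarrow> [x ^ (x0 ^ n - 1) = 1] (mod p)"
  proof -
    have x0n: "x0 ^ n = Suc (x0 ^ n - 1)" using x0(1) by simp
    have "[Suc N = Suc (x0 ^ n - 1)] (mod p - 1)"
      using cong_pow[OF x0(2), of n] unfolding N x0n[symmetric] .
    then have "[N = x0 ^ n - 1] (mod p - 1)"
      using cong_add_rcancel_nat[of N 1] by simp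
    moreover have "ord p x dvd p - 1"
      using fermat unfolding ord_divides .
    ultimately have "[N = x0 ^ n - 1] (mod ord p x)"
      by (rule cong_dvd_modulus_nat)
    then have "[x ^ N = x ^ (x0 ^ n - 1)] (mod p)"
      using order_divides_expdiff[of p x] cop[of 1] by (simp add: coprime_commute)
    then show ?thesis by (meson cong_sym cong_trans)
  qed
  moreover have "[x ^ ((p - 1) * N) = 1] (mod p ^ e) \<longleftrightarrow>
      [x ^ (p - 1) = 1] (mod p ^ e) \<or> [x ^ n = 1] (mod p) \<and> [x ^ (p - 1) = 1] (mod p ^ J)"
  proof -
    define X where "X = int x"
    define D where "D = X ^ (p - 1) - 1"
    have to_int: "[x ^ i = 1] (mod p ^ k) \<longleftrightarrow> int p ^ k dvd X ^ i - 1" for i k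
      using cong_int_iff[of "x ^ i" 1 "p ^ k"] by (simp add: cong_iff_dvd_diff X_def)
    have to_int': "[x ^ i = 1] (mod p) \<longleftrightarrow> int p dvd X ^ i - 1" for i
      using to_int[of i 1] by simp
    have D1: "int p dvd D" unfolding D_def using fermat to_int' by blast
    have unit: "\<not> is_unit (int p)" and pe: "prime_elem (int p)" using p(1) by auto
    have N_int: "int N = X ^ n - 1"
      using arg_cong[OF N, of int] by (simp add: X_def)
    have "[x ^ ((p - 1) * N) = 1] (mod p ^ e) \<longleftrightarrow> int p ^ e dvd (X ^ (p - 1)) ^ N - 1"
      unfolding to_int by (simp only: power_mult)
    also have "\<dots> \<longleftrightarrow> int p ^ e dvd (X ^ n - 1) * D"
      unfolding D_def N_int[symmetric] using p D1[unfolded D_def]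
      by (intro lifting_the_exponent) (auto simp: cong_iff_dvd_diff)
    also have "\<dots> \<longleftrightarrow> int p ^ e dvd D \<or> int p dvd X ^ n - 1 \<and> int p ^ J dvd D"
    proof (cases "D = 0 \<or> \<not> int p dvd X ^ n - 1")
      case True
      then show ?thesis
      proof
        assume "\<not> int p dvd X ^ n - 1"
        then have "coprime (int p ^ e) (X ^ n - 1)"
          using p(1) by (intro coprime_power_left_iff[THEN iffD2] disjI1 prime_imp_coprime) auto
        then show ?thesis
          using \<open>\<not> int p dvd X ^ n - 1\<close> by (simp add: coprime_dvd_mult_right_iff)
      qed simp
    next
      case False
      define j where "j = multiplicity (int p) D"
      have X1: "X \<noteq> 1" using False by (auto simp: D_def)
      then have X2: "X \<ge> 2" using x_pos by (simp add: X_def)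
      have X3: "X ^ m \<noteq> 1" if "m > 0" for m
        proof -
        have "1 < X ^ m" using X2 that by (intro one_less_power) auto
        then show ?thesis by simp
      qed
      \<comment> \<open>\<open>X ^ n\<close> and \<open>X ^ (p - 1)\<close> are both one-units; evaluating \<open>X ^ (n * (p - 1)) - 1\<close> from either
        side gives the valuation of \<open>X ^ n - 1\<close>.\<close>
      have "multiplicity (int p) ((X ^ n) ^ (p - 1) - 1)
          = multiplicity p (p - 1) + multiplicity (int p) (X ^ n - 1)"
        using p False X3 n p1 by (intro multiplicity_power_minus_one)
          (auto simp: cong_iff_dvd_diff simp flip: power_mult)
      moreover have "multiplicity (int p) ((X ^ (p - 1)) ^ n - 1) = multiplicity p n + j"
        unfolding j_def D_def using p D1 X3 n p1 by (intro multiplicity_power_minus_one)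
          (auto simp: cong_iff_dvd_diff D_def simp flip: power_mult)
      moreover have "multiplicity p (p - 1) = 0"
        using p1 by (intro not_dvd_imp_multiplicity_0) (auto dest: dvd_imp_le)
      ultimately have "multiplicity (int p) (X ^ n - 1) = multiplicity p n + j"
        by (simp add: mult.commute flip: power_mult)
      then have "multiplicity (int p) ((X ^ n - 1) * D) = multiplicity p n + 2 * j"
        using prime_elem_multiplicity_mult_distrib[OF pe, of "X ^ n - 1" D] X3[OF n] False
        by (simp add: j_def)
      then have "int p ^ e dvd (X ^ n - 1) * D \<longleftrightarrow> e \<le> multiplicity p n + 2 * j"
        using X3[OF n] False unit by (simp add: power_dvd_iff_le_multiplicity)
      moreover have "int p ^ i dvd D \<longleftrightarrow> i \<le> j" for i
        using False unit by (simp add: power_dvd_iff_le_multiplicity j_def)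
      moreover have "1 \<le> j"
        using D1 False unit power_dvd_iff_le_multiplicity[of D "int p" 1] by (simp add: j_def)
      moreover from this have "e \<le> multiplicity p n + 2 * j \<longleftrightarrow> e \<le> j \<or> J \<le> j"
        unfolding J_def by arith
      ultimately show ?thesis
        using False by simp
    qed
    finally show ?thesis
      unfolding to_int to_int' D_def .
  qed
  ultimately show ?thesis
    using step1 cong_1_mod_prime_power_iff[OF p(1) e, of x N] by blast
qed

text \<open>Group the solutions by \<open>x0\<close> in \<open>{1..p - 1}\<close> with \<open>x = x0\<close> modulo \<open>p - 1\<close> and by the residue \<open>a\<close> of \<open>x\<close>
  modulo \<open>p\<close>. A group is empty unless \<open>a ^ (x0 ^ n - 1) = 1\<close>. Otherwise it has one element, and
  \<open>p ^ (e - J) - 1\<close> further ones if also \<open>a ^ n = 1\<close>.\<close>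

lemma num_sols_eq:
  assumes p: "prime p" "p \<noteq> 2" and n: "n > 0" and e: "e \<ge> 1"
  defines "J \<equiv> max 1 ((e - multiplicity p n + 1) div 2)"
  shows "num_sols p n e = (\<Sum>x0 = 1..p - 1. gcd (p - 1) (x0 ^ n - 1)) +
    (\<Sum>x0 = 1..p - 1. gcd (gcd (p - 1) n) (x0 ^ n - 1) * (p ^ (e - J) - 1))"
proof -
  have p1: "p > 2" using p prime_ge_2_nat[of p] by simp
  have J: "1 \<le> J" "J \<le> e" using e by (auto simp: J_def)
  define R where "R x0 = {a \<in> {1..p - 1}. [a ^ (x0 ^ n - 1) = 1] (mod p)}" for x0
  define S where "S = {x \<in> {1..p ^ e * (p - 1)}. \<not> p dvd x \<and> [x ^ (x ^ n) = x] (mod p ^ e)}"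
  \<comment> \<open>The representative of \<open>x\<close> modulo \<open>p - 1\<close> is taken in \<open>{1..p - 1}\<close>, hence the shift by one.\<close>
  define cls where "cls x = (Suc ((x - 1) mod (p - 1)), x mod p)" for x
  have cls: "cls x = (x0, a) \<longleftrightarrow> [x = x0] (mod p - 1) \<and> [x = a] (mod p)"
    if "x \<ge> 1" "x0 \<in> {1..p - 1}" "a \<in> {1..p - 1}" for x x0 a
  proof -
    have "[x = x0] (mod p - 1) \<longleftrightarrow> [Suc (x - 1) = Suc (x0 - 1)] (mod p - 1)"
      using that by simp
    also have "\<dots> \<longleftrightarrow> [x - 1 = x0 - 1] (mod p - 1)"
      using cong_add_rcancel_nat[of "x - 1" 1 "x0 - 1"] by simp
    also have "\<dots> \<longleftrightarrow> Suc ((x - 1) mod (p - 1)) = x0"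
      using that by (auto simp: cong_def)
    moreover have "a mod p = a" using that(3) p1 by (intro mod_less) auto
    ultimately show ?thesis
      by (auto simp: cls_def cong_def)
  qed
  have fib: "card {x \<in> S. cls x = (x0, a)} =
      (if a \<in> R x0 then 1 + (if [a ^ n = 1] (mod p) then p ^ (e - J) - 1 else 0) else 0)"
    if x0: "x0 \<in> {1..p - 1}" and a: "a \<in> {1..p - 1}" for x0 a
  proof -
    have ap: "\<not> p dvd a" using a p1 by (auto dest: dvd_imp_le)
    have iff: "x \<in> S \<and> cls x = (x0, a) \<longleftrightarrow> x \<in> {1..p ^ e * (p - 1)} \<and> [x = x0] (mod p - 1) \<and> [x = a] (mod p) \<and>
        a \<in> R x0 \<and> ([x ^ (p - 1) = 1] (mod p ^ e) \<or> [a ^ n = 1] (mod p) \<and> [x ^ (p - 1) = 1] (mod p ^ J))"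
      (is "?L \<longleftrightarrow> ?R") for x
    proof (cases "x \<in> {1..p ^ e * (p - 1)} \<and> [x = x0] (mod p - 1) \<and> [x = a] (mod p)")
      case True
      then have "\<not> p dvd x" using ap by (auto simp: cong_dvd_iff)
      moreover have "[x ^ i = 1] (mod p) \<longleftrightarrow> [a ^ i = 1] (mod p)" for i
        using True cong_pow[of x a p i] by (meson cong_sym cong_trans)
      ultimately show ?thesis
        using True power_power_self_cong_iff[OF p n e, of x x0] x0 a cls[of x x0 a]
        by (simp add: S_def R_def J_def)
    next
      case False
      then show ?thesis using cls[of x x0 a] x0 a by (auto simp: S_def)
    qed
    have sub: "[x ^ (p - 1) = 1] (mod p ^ J)" if "[x ^ (p - 1) = 1] (mod p ^ e)" for x
      using that J by (auto intro: cong_dvd_modulus_nat le_imp_power_dvd)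
    consider "a \<notin> R x0" | "a \<in> R x0" "[a ^ n = 1] (mod p)" | "a \<in> R x0" "[a ^ n \<noteq> 1] (mod p)"
      by blast
    then show ?thesis
    proof cases
      case 1
      then have "{x \<in> S. cls x = (x0, a)} = {}" using iff by blast
      then show ?thesis using 1 by (simp only: card.empty if_False)
    next
      case 2
      then have "{x \<in> S. cls x = (x0, a)} = {x \<in> {1..p ^ e * (p - 1)}. [x = x0] (mod p - 1) \<and>
          [x = a] (mod p) \<and> [x ^ (p - 1) = 1] (mod p ^ J)}"
        using iff sub by blast
      then show ?thesis
        using card_teichmuller_class[OF p(1) J a, of x0] 2 p1 by simp
    next
      case 3
      then have "{x \<in> S. cls x = (x0, a)} = {x \<in> {1..p ^ e * (p - 1)}. [x = x0] (mod p - 1) \<and>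
          [x = a] (mod p) \<and> [x ^ (p - 1) = 1] (mod p ^ e)}"
        using iff by blast
      then show ?thesis
        using card_teichmuller_class[OF p(1) e order_refl a, of x0] 3 by simp
    qed
  qed
  have "cls ` S \<subseteq> {1..p - 1} \<times> {1..p - 1}"
  proof safe
    fix x x0 a assume x: "x \<in> S" "(x0, a) = cls x"
    have "Suc ((x - 1) mod (p - 1)) \<le> p - 1" "x mod p \<le> p - 1"
      using p1 mod_less_divisor[of "p - 1" "x - 1"] mod_less_divisor[of p x] by linarith+
    then show "x0 \<in> {1..p - 1}" "a \<in> {1..p - 1}"
      using x by (auto simp: cls_def S_def dvd_eq_mod_eq_0)
  qed
  then have "card S = (\<Sum>y\<in>{1..p - 1} \<times> {1..p - 1}. card {x \<in> S. cls x = y})"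
    using sum.group[of S "{1..p - 1} \<times> {1..p - 1}" cls "\<lambda>_. 1::nat"] by (simp add: S_def)
  also have "\<dots> = (\<Sum>x0 = 1..p - 1. \<Sum>a = 1..p - 1. card {x \<in> S. cls x = (x0, a)})"
    by (simp add: sum.cartesian_product)
  also have "\<dots> = (\<Sum>x0 = 1..p - 1. gcd (p - 1) (x0 ^ n - 1) +
      gcd (gcd (p - 1) n) (x0 ^ n - 1) * (p ^ (e - J) - 1))"
  proof (rule sum.cong[OF refl])
    fix x0 assume x0: "x0 \<in> {1..p - 1}"
    have R_sub: "R x0 \<subseteq> {1..p - 1}" by (auto simp: R_def)
    have "(\<Sum>a = 1..p - 1. card {x \<in> S. cls x = (x0, a)})
        = (\<Sum>a\<in>R x0. 1 + (if [a ^ n = 1] (mod p) then p ^ (e - J) - 1 else 0))"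
      using R_sub by (intro sum.mono_neutral_cong_right) (auto simp: fib[OF x0])
    also have "\<dots> = card (R x0) + card {a \<in> R x0. [a ^ n = 1] (mod p)} * (p ^ (e - J) - 1)"
      using R_sub finite_subset[OF R_sub] unfolding sum.distrib
      by (simp add: sum.inter_filter[symmetric])
    also have "{a \<in> R x0. [a ^ n = 1] (mod p)} = {a \<in> {1..p - 1}. [a ^ gcd n (x0 ^ n - 1) = 1] (mod p)}"
      unfolding R_def ord_divides gcd_greatest_iff by blast
    finally show "(\<Sum>a = 1..p - 1. card {x \<in> S. cls x = (x0, a)}) = gcd (p - 1) (x0 ^ n - 1) +
      gcd (gcd (p - 1) n) (x0 ^ n - 1) * (p ^ (e - J) - 1)"
      unfolding R_def card_roots_of_unity_mod_prime[OF p(1)] gcd.assoc .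
  qed
  finally show ?thesis
    by (simp add: num_sols_def S_def sum.distrib)
qed

section \<open>Rational numbers divisible by a power of a prime\<close>

text \<open>The ideal generated by \<open>p ^ m\<close> in the localization of the integers at \<open>p\<close>. At integers, truncations
  of the two power series are rational numbers; estimating them in these ideals replaces
  computations with divisions in the ring of \<open>p\<close>-adic integers.\<close>

definition localization_ideal :: "nat \<Rightarrow> nat \<Rightarrow> rat set" where
  "localization_ideal p m =
     {r. \<exists>a b. coprime (int p) b \<and> b \<noteq> 0 \<and> r = of_int (int p ^ m * a) / of_int b}"

lemma localization_idealI:
  "coprime (int p) b \<Longrightarrow> b \<noteq> 0 \<Longrightarrow> r = of_int (int p ^ m * a) / of_int b \<Longrightarrow> r \<in> localization_ideal p m"
  by (auto simp: localization_ideal_def)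

lemma localization_ideal_of_int: 
  "int p ^ m dvd z \<Longrightarrow> of_int z \<in> localization_ideal p m"
  by (auto elim!: dvdE intro!: localization_idealI[of p 1])

lemma of_int_in_localization_ideal_iff:
  "of_int z \<in> localization_ideal p m \<longleftrightarrow> int p ^ m dvd z"
proof
  assume "of_int z \<in> localization_ideal p m"
  then obtain a b where ab: "coprime (int p) b" "b \<noteq> 0" "of_int z = of_int (int p ^ m * a) / (of_int b :: rat)"
    by (auto simp: localization_ideal_def)
  then have "of_int (z * b) = (of_int (int p ^ m * a) :: rat)"
    by (simp add: field_simps)
  then have "z * b = int p ^ m * a"
    unfolding of_int_eq_iff .
  then have "int p ^ m dvd z * b" by simp
  then show "int p ^ m dvd z"
    using ab(1) by (simp add: coprime_dvd_mult_left_iff)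
qed (rule localization_ideal_of_int)

lemma localization_ideal_0 [simp]: "0 \<in> localization_ideal p m"
  using localization_ideal_of_int[of p m 0] by simp

lemma localization_ideal_add:
  assumes "r \<in> localization_ideal p m" "s \<in> localization_ideal p m"
  shows "r + s \<in> localization_ideal p m"
proof -
  obtain a b where ab: "coprime (int p) b" "b \<noteq> 0" "r = of_int (int p ^ m * a) / of_int b"
    using assms(1) by (auto simp: localization_ideal_def)
  obtain c d where cd: "coprime (int p) d" "d \<noteq> 0" "s = of_int (int p ^ m * c) / of_int d"
    using assms(2) by (auto simp: localization_ideal_def)
  have "r + s = of_int (int p ^ m * (a * d + c * b)) / of_int (b * d)"
    using ab cd by (simp add: field_simps)
  moreover have "coprime (int p) (b * d)" "b * d \<noteq> 0"
    using ab cd by auto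
  ultimately show ?thesis
    by (rule localization_idealI[rotated 2])
qed

lemma localization_ideal_mult:
  assumes "r \<in> localization_ideal p m" "s \<in> localization_ideal p k"
  shows "r * s \<in> localization_ideal p (m + k)"
proof -
  obtain a b where ab: "coprime (int p) b" "b \<noteq> 0" "r = of_int (int p ^ m * a) / of_int b"
    using assms(1) by (auto simp: localization_ideal_def)
  obtain c d where cd: "coprime (int p) d" "d \<noteq> 0" "s = of_int (int p ^ k * c) / of_int d"
    using assms(2) by (auto simp: localization_ideal_def)
  have "r * s = of_int (int p ^ (m + k) * (a * c)) / of_int (b * d)"
    using ab cd by (simp add: field_simps power_add)
  moreover have "coprime (int p) (b * d)" "b * d \<noteq> 0"
    using ab cd by auto
  ultimately show ?thesis
    by (rule localization_idealI[rotated 2])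
qed

lemma localization_ideal_mono:
  assumes "r \<in> localization_ideal p k" "m \<le> k"
  shows "r \<in> localization_ideal p m"
proof -
  obtain a b where ab: "coprime (int p) b" "b \<noteq> 0" "r = of_int (int p ^ k * a) / of_int b"
    using assms(1) by (auto simp: localization_ideal_def)
  have "int p ^ k * a = int p ^ m * (int p ^ (k - m) * a)"
    using assms(2) by (simp flip: power_add mult.assoc)
  with ab show ?thesis
    by (metis localization_idealI)
qed

lemma localization_ideal_mult_left:
  assumes "r \<in> localization_ideal p 0" "s \<in> localization_ideal p m"
  shows "r * s \<in> localization_ideal p m"
  using localization_ideal_mult[OF assms] by simp

lemma localization_ideal_minus:
  "r \<in> localization_ideal p m \<Longrightarrow> - r \<in> localization_ideal p m"
  using localization_ideal_mult_left[OF localization_ideal_of_int[of p 0 "-1"], of r m] by simp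

lemma localization_ideal_sum:
  "(\<And>i. i \<in> A \<Longrightarrow> f i \<in> localization_ideal p m) \<Longrightarrow> sum f A \<in> localization_ideal p m"
  by (induction A rule: infinite_finite_induct) (auto intro: localization_ideal_add)

lemma localization_ideal_power:
  "r \<in> localization_ideal p m \<Longrightarrow> r ^ k \<in> localization_ideal p (m * k)"
proof (induction k)
  case 0
  then show ?case using localization_ideal_of_int[of p 0 1] by simp
next
  case (Suc k)
  then show ?case using localization_ideal_mult[of r p m "r ^ k" "m * k"] by simp
qed

lemma localization_ideal_trans:
  "r - s \<in> localization_ideal p m \<Longrightarrow> s - t \<in> localization_ideal p m \<Longrightarrow> r - t \<in> localization_ideal p m"
  using localization_ideal_add[of "r - s" p m "s - t"] by simp

lemma localization_ideal_power_diff: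
  assumes "r - s \<in> localization_ideal p m" "r \<in> localization_ideal p 0" "s \<in> localization_ideal p 0"
  shows "r ^ k - s ^ k \<in> localization_ideal p m"
proof (induction k)
  case (Suc k)
  have "r * (r ^ k - s ^ k) \<in> localization_ideal p m"
    using assms(2) Suc by (rule localization_ideal_mult_left)
  moreover have "s ^ k * (r - s) \<in> localization_ideal p m"
    using localization_ideal_power[OF assms(3), of k] assms(1) by (intro localization_ideal_mult_left) simp
  ultimately have "r * (r ^ k - s ^ k) + s ^ k * (r - s) \<in> localization_ideal p m"
    by (rule localization_ideal_add)
  then show ?case by (simp add: algebra_simps)
qed simp

text \<open>A division by \<open>d\<close> costs as many powers of \<open>p\<close> as \<open>d\<close> contains.\<close>

lemma localization_ideal_divide:
  assumes p: "prime p" and r: "r \<in> localization_ideal p (m + multiplicity p d)" and d: "d > 0"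
  shows "r / of_nat d \<in> localization_ideal p m"
proof -
  obtain d' where d': "d = p ^ multiplicity p d * d'" "\<not> p dvd d'"
    by (rule multiplicity_decompose'[of d p]) (use p d in auto)
  have "coprime (int p) (int d')"
    using d'(2) p by (simp add: prime_imp_coprime)
  obtain a b where ab: "coprime (int p) b" "b \<noteq> 0"
    "r = of_int (int p ^ (m + multiplicity p d) * a) / of_int b"
    using r by (auto simp: localization_ideal_def)
  define v where "v = multiplicity p d"
  have p0: "p > 0" using p by (rule prime_gt_0_nat)
  have "d' > 0" using d'(2) by (auto intro: gr0I)
  have "of_nat d = (of_nat p ^ v * of_nat d' :: rat)"
    unfolding v_def by (subst d'(1)) simp
  then have "r / of_nat d = of_int (int p ^ m * a) / of_int (b * int d')"
    using ab p0 \<open>d' > 0\<close> by (simp add: v_def[symmetric] power_add)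
  moreover have "coprime (int p) (b * int d')" "b * int d' \<noteq> 0"
    using ab \<open>coprime (int p) (int d')\<close> \<open>d' > 0\<close> by auto
  ultimately show ?thesis
    by (rule localization_idealI[rotated 2])
qed

section \<open>Truncated exponential and logarithm series\<close>

text \<open>Legendre's recursion: among the factors of the factorial only the multiples of \<open>p\<close> count, and
  dividing these by \<open>p\<close> leaves the factorial of \<open>q\<close>.\<close>

lemma multiplicity_fact_mult_add:
  fixes p :: nat
  assumes p: "prime p" and r: "r < p"
  shows "multiplicity p (fact (p * q + r)) = q + multiplicity p (fact q)"
proof -
  have unit: "\<not> is_unit p" and pe: "prime_elem p" and p1: "p > 1"
    using p prime_gt_1_nat[OF p] by auto
  have step: "multiplicity p (fact (p * q + r)) = multiplicity p (fact (p * q))" if "r < p" for q r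
    using that
  proof (induction r)
    case (Suc r)
    have "\<not> p dvd Suc r" using Suc.prems by (auto dest: dvd_imp_le)
    then have "\<not> p dvd Suc (p * q + r)"
      by (metis add_Suc_right dvd_add_right_iff dvd_triv_left)
    then have "multiplicity p (Suc (p * q + r)) = 0"
      by (rule not_dvd_imp_multiplicity_0)
    then show ?case
      using Suc prime_elem_multiplicity_mult_distrib[OF pe, of "Suc (p * q + r)" "fact (p * q + r)"]
      by simp
  qed simp
  have "multiplicity p (fact (p * q)) = q + multiplicity p (fact q)"
  proof (induction q)
    case (Suc q)
    have eq: "p * Suc q = Suc (p * q + (p - 1))" using p1 by simp
    have "fact (p * Suc q) = p * (Suc q * fact (p * q + (p - 1)))"
      unfolding eq fact_Suc of_nat_id unfolding eq[symmetric] by (simp only: mult.assoc)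
    also have "multiplicity p \<dots> = Suc (multiplicity p (Suc q) + multiplicity p (fact (p * q + (p - 1))))"
      using p1 unit pe by (simp add: multiplicity_times_same prime_elem_multiplicity_mult_distrib del: mult_Suc)
    also have "multiplicity p (fact (p * q + (p - 1))) = q + multiplicity p (fact q)"
      using step[of "p - 1" q] Suc p1 by simp
    also have "Suc (multiplicity p (Suc q) + (q + multiplicity p (fact q))) = Suc q + multiplicity p (fact (Suc q))"
      using prime_elem_multiplicity_mult_distrib[OF pe, of "Suc q" "fact q"] by simp
    finally show ?case .
  qed simp
  then show ?thesis using step[OF r] by simp
qed

text \<open>For odd \<open>p\<close> the powers of an element divisible by \<open>p\<close> gain factors \<open>p\<close> at least twice as fast as the
  factorials. All convergence and error estimates below rest on this bound.\<close>

lemma multiplicity_fact_le: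
  fixes p :: nat
  assumes p: "prime p" "p \<noteq> 2"
  shows "multiplicity p (fact k) \<le> (k - 1) div 2"
proof (induction k rule: less_induct)
  case (less k)
  have p3: "p \<ge> 3" using p prime_ge_2_nat[of p] by simp
  define q where "q = k div p"
  have k: "k = p * q + k mod p" by (simp add: q_def)
  have v: "multiplicity p (fact k) = q + multiplicity p (fact q)"
    using multiplicity_fact_mult_add[OF p(1), of "k mod p" q] p3 k by simp
  show ?case
  proof (cases "q = 0")
    case False
    have "3 * q \<le> k"
      using p3 k by (metis le_add1 mult_le_mono1 order_trans)
    moreover from this False have "multiplicity p (fact q) \<le> (q - 1) div 2"
      by (intro less.IH) simp
    ultimately show ?thesis
      using v False by simp
  qed (use v in simp)
qed

lemma multiplicity_Suc_le:
  fixes p :: nat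
  assumes "prime p" "p \<noteq> 2"
  shows "multiplicity p (Suc k) \<le> k div 2"
proof -
  have "multiplicity p (Suc k) \<le> multiplicity p (fact (Suc k))"
    by (intro dvd_imp_multiplicity_le dvd_fact) simp_all
  also have "\<dots> \<le> k div 2"
    using multiplicity_fact_le[OF assms, of "Suc k"] by simp
  finally show ?thesis .
qed

lemma power_divide_fact_in_localization_ideal:
  assumes p: "prime p" "p \<noteq> 2" and y: "y \<in> localization_ideal p m" "m \<ge> 1"
  shows "y ^ k / fact k \<in> localization_ideal p (m * k - (k - 1) div 2)"
proof -
  have "(k - 1) div 2 \<le> m * k"
    using y(2) by (cases m) auto
  then have "m * k - (k - 1) div 2 + multiplicity p (fact k) \<le> m * k"
    using multiplicity_fact_le[OF p, of k] by simp
  then have "y ^ k / of_nat (fact k) \<in> localization_ideal p (m * k - (k - 1) div 2)"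
    by (intro localization_ideal_divide p localization_ideal_mono[OF localization_ideal_power[OF y(1)]]) auto
  then show ?thesis by simp
qed

definition exp_partial :: "nat \<Rightarrow> rat \<Rightarrow> rat" where
  "exp_partial N y = (\<Sum>k<N. y ^ k / fact k)"

definition log_partial :: "nat \<Rightarrow> rat \<Rightarrow> rat" where
  "log_partial N t = (\<Sum>k<N. (- 1) ^ k * t ^ Suc k / of_nat (Suc k))"

text \<open>The terms of the product with \<open>i + j < N\<close> are the binomial expansion of the truncated series at
  \<open>a + b\<close>; the others have \<open>i + j \<ge> N\<close>, and each power of \<open>a\<close> or \<open>b\<close> keeps at least half of its factors
  \<open>p\<close> when it is divided by the factorial.\<close>

lemma exp_partial_add:
  assumes p: "prime p" "p \<noteq> 2" and a: "a \<in> localization_ideal p 1" and b: "b \<in> localization_ideal p 1"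
  shows "exp_partial N a * exp_partial N b - exp_partial N (a + b) \<in> localization_ideal p (N div 2)"
proof -
  define f where "f = (\<lambda>(i, j). (a ^ i / fact i) * (b ^ j / fact j))"
  have expand: "(a + b) ^ k / fact k = (\<Sum>i\<le>k. f (i, k - i))" for k
  proof -
    have "(a + b) ^ k / fact k = (\<Sum>i\<le>k. of_nat (k choose i) * a ^ i * b ^ (k - i) / fact k)"
      unfolding binomial_ring sum_divide_distrib ..
    also have "\<dots> = (\<Sum>i\<le>k. f (i, k - i))"
      by (intro sum.cong refl) (simp add: f_def binomial_fact)
    finally show ?thesis .
  qed
  define T where "T = {(i, j). i + j < N}"
  have "exp_partial N (a + b) = sum f T"
    using sum.triangle_reindex[of "\<lambda>i j. f (i, j)" N]
    by (simp add: exp_partial_def expand T_def)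
  moreover have "exp_partial N a * exp_partial N b = sum f ({..<N} \<times> {..<N})"
    by (simp add: exp_partial_def sum_product sum.cartesian_product f_def)
  moreover have "T \<subseteq> {..<N} \<times> {..<N}" by (auto simp: T_def)
  ultimately have "exp_partial N a * exp_partial N b - exp_partial N (a + b) = sum f ({..<N} \<times> {..<N} - T)"
    by (simp add: sum_diff)
  also have "\<dots> \<in> localization_ideal p (N div 2)"
  proof (rule localization_ideal_sum)
    fix ij assume "ij \<in> {..<N} \<times> {..<N} - T"
    then obtain i j where ij: "ij = (i, j)" "i + j \<ge> N" by (auto simp: T_def)
    have "f ij \<in> localization_ideal p ((1 * i - (i - 1) div 2) + (1 * j - (j - 1) div 2))"
      unfolding ij f_def prod.case using p a b
      by (intro localization_ideal_mult power_divide_fact_in_localization_ideal) auto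
    then show "f ij \<in> localization_ideal p (N div 2)"
      by (rule localization_ideal_mono) (use ij in linarith)
  qed
  finally show ?thesis .
qed

lemma exp_partial_in_localization:
  assumes "prime p" "p \<noteq> 2" and "y \<in> localization_ideal p 1"
  shows "exp_partial N y \<in> localization_ideal p 0"
  unfolding exp_partial_def
  using power_divide_fact_in_localization_ideal[OF assms]
  by (intro localization_ideal_sum) (auto intro: localization_ideal_mono)

lemma exp_partial_power:
  assumes p: "prime p" "p \<noteq> 2" and y: "y \<in> localization_ideal p 1"
  shows "exp_partial N y ^ k - exp_partial N (of_nat k * y) \<in> localization_ideal p (N div 2)"
proof (induction k)
  case 0
  have "exp_partial N 0 = (if N = 0 then 0 else 1)"
    by (cases N) (simp_all add: exp_partial_def sum.lessThan_Suc_shift del: sum.lessThan_Suc)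
  then show ?case
    using localization_ideal_of_int[of p 0 1] by auto
next
  case (Suc k)
  have ky: "of_nat k * y \<in> localization_ideal p 1"
    using localization_ideal_mult_left[OF localization_ideal_of_int[of p 0 "int k"] y] by simp
  have "exp_partial N y * (exp_partial N y ^ k - exp_partial N (of_nat k * y)) \<in> localization_ideal p (N div 2)"
    using exp_partial_in_localization[OF p y] Suc by (rule localization_ideal_mult_left)
  from localization_ideal_add[OF this exp_partial_add[OF p y ky]] show ?case
    by (simp add: algebra_simps)
qed

lemma exp_partial_linear:
  assumes p: "prime p" "p \<noteq> 2" and y: "y \<in> localization_ideal p m" "m \<ge> 1" and N: "N \<ge> 2"
  shows "exp_partial N y - (1 + y) \<in> localization_ideal p (2 * m)"
proof -
  obtain M where M: "N = Suc (Suc M)" using N by (metis add_2_eq_Suc le_Suc_ex)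
  have "exp_partial N y - (1 + y) = (\<Sum>k<M. y ^ Suc (Suc k) / fact (Suc (Suc k)))"
    unfolding exp_partial_def M sum.lessThan_Suc_shift by simp
  also have "\<dots> \<in> localization_ideal p (2 * m)"
  proof (rule localization_ideal_sum)
    fix k
    have "m * k \<ge> k" using y(2) by (cases m) auto
    then have "Suc k div 2 \<le> m * k" by linarith
    then have "2 * m \<le> m * Suc (Suc k) - (Suc (Suc k) - 1) div 2"
      by simp
    then show "y ^ Suc (Suc k) / fact (Suc (Suc k)) \<in> localization_ideal p (2 * m)"
      using localization_ideal_mono[OF power_divide_fact_in_localization_ideal[OF p y]] by blast
  qed
  finally show ?thesis .
qed

text \<open>Up to the factorial, the binomial coefficient is the product of the numbers \<open>q - i\<close> for
  \<open>1 \<le> i \<le> k\<close>, and modulo \<open>q\<close> each of them is \<open>- i\<close>.\<close>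

lemma binomial_pred_times_fact:
  assumes "q > 0"
  shows "\<exists>z. int ((q - 1) choose k) * fact k = (- 1) ^ k * fact k + int q * z"
proof (induction k)
  case (Suc k)
  then obtain z where z: "int ((q - 1) choose k) * fact k = (- 1) ^ k * fact k + int q * z" ..
  define n where "n = q - 1"
  have "Suc k * (n choose Suc k) = (n - k) * (n choose k)"
    using binomial_absorption[of k n] binomial_absorb_comp[of n k] by simp
  then have "int (Suc k) * int (n choose Suc k) = int (n - k) * int (n choose k)"
    by (metis of_nat_mult)
  also have "\<dots> = (int q - int (Suc k)) * int (n choose k)"
  proof (cases "k \<le> n")
    case True
    then show ?thesis using assms by (simp add: n_def of_nat_diff)
  qed simp
  finally have absorb: "int (Suc k) * int (n choose Suc k) = (int q - int (Suc k)) * int (n choose k)" .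
  have "int (n choose Suc k) * fact (Suc k) = (int (Suc k) * int (n choose Suc k)) * fact k"
    by (simp only: fact_Suc mult_ac)
  also have "\<dots> = (int q - int (Suc k)) * (int (n choose k) * fact k)"
    unfolding absorb by (simp only: mult_ac)
  also have "\<dots> = (- 1) ^ Suc k * fact (Suc k) + int q * ((- 1) ^ k * fact k + int q * z - int (Suc k) * z)"
    unfolding n_def z fact_Suc by (simp add: algebra_simps)
  finally show ?case
    unfolding n_def by blast
qed simp

text \<open>In the binomial expansion of \<open>(1 + t) ^ q\<close> with \<open>q = p ^ m\<close>, the coefficient of \<open>t ^ (k + 1)\<close> is
  \<open>q / (k + 1)\<close> times the binomial coefficient of \<open>q - 1\<close> over \<open>k\<close>. By \<open>binomial_pred_times_fact\<close> it
  differs from \<open>q * (- 1) ^ k / (k + 1)\<close> by a multiple of \<open>q ^ 2 / (k + 1)!\<close>, and the factorial is absorbed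
  by \<open>t ^ (k + 1)\<close>. This is the limit formula \<open>log (1 + t) = lim ((1 + t) ^ q - 1) / q\<close> with an error
  bound.\<close>

lemma one_plus_power_eq_log_partial:
  assumes p: "prime p" "p \<noteq> 2" and t: "t \<in> localization_ideal p 1" and N: "N \<ge> p ^ m"
  shows "(1 + t) ^ (p ^ m) - (1 + of_nat (p ^ m) * log_partial N t) \<in> localization_ideal p (2 * m)"
proof -
  define q where "q = p ^ m"
  have q: "q > 0" using p(1) by (simp add: q_def prime_gt_0_nat)
  have qq: "of_nat q \<in> localization_ideal p m"
    using localization_ideal_of_int[of p m "int q"] by (simp add: q_def)
  have "(1 + t) ^ q = (\<Sum>k\<le>q. of_nat (q choose k) * t ^ k)"
    using binomial_ring[of t 1 q] by (simp add: add.commute)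
  also have "\<dots> = 1 + (\<Sum>k<q. of_nat (q choose Suc k) * t ^ Suc k)"
    by (simp add: sum.lessThan_Suc_shift flip: lessThan_Suc_atMost del: sum.lessThan_Suc)
  also have "(\<Sum>k<q. of_nat (q choose Suc k) * t ^ Suc k) = (\<Sum>k<N. of_nat (q choose Suc k) * t ^ Suc k)"
    using N by (intro sum.mono_neutral_left) (auto simp: q_def)
  finally have "(1 + t) ^ q - (1 + of_nat q * log_partial N t)
      = (\<Sum>k<N. of_nat (q choose Suc k) * t ^ Suc k - of_nat q * ((- 1) ^ k * t ^ Suc k / of_nat (Suc k)))"
    by (simp add: log_partial_def sum_distrib_left sum_subtractf)
  also have "\<dots> \<in> localization_ideal p (2 * m)"
  proof (rule localization_ideal_sum)
    fix k
    obtain z where "int ((q - 1) choose k) * fact k = (- 1) ^ k * fact k + int q * z"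
      using binomial_pred_times_fact[OF q] by blast
    then have "of_int (int ((q - 1) choose k) * fact k) = (of_int ((- 1) ^ k * fact k + int q * z) :: rat)"
      by (rule arg_cong)
    then have z: "of_nat ((q - 1) choose k) = ((- 1) ^ k + of_nat q * of_int z / fact k :: rat)"
      by (simp add: field_simps)
    have "Suc k * (q choose Suc k) = q * ((q - 1) choose k)"
      by (rule binomial_absorption)
    then have "of_nat (Suc k) * of_nat (q choose Suc k) = (of_nat q * of_nat ((q - 1) choose k) :: rat)"
      by (metis of_nat_mult)
    then have c: "of_nat (q choose Suc k) = (of_nat q * of_nat ((q - 1) choose k) / of_nat (Suc k) :: rat)"
      by (simp add: field_simps del: of_nat_Suc)
    have "of_nat (q choose Suc k) * t ^ Suc k - of_nat q * ((- 1) ^ k * t ^ Suc k / of_nat (Suc k))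
        = of_nat q * of_nat q * (of_int z * (t ^ Suc k / fact (Suc k)))"
      unfolding c z by (simp add: divide_simps) (simp add: algebra_simps)
    also have "\<dots> \<in> localization_ideal p (m + m + (0 + 0))"
      using p t by (intro localization_ideal_mult qq localization_ideal_of_int
        localization_ideal_mono[OF power_divide_fact_in_localization_ideal]) auto
    finally show "of_nat (q choose Suc k) * t ^ Suc k - of_nat q * ((- 1) ^ k * t ^ Suc k / of_nat (Suc k))
        \<in> localization_ideal p (2 * m)"
      by (simp add: mult_2)
  qed
  finally show ?thesis by (simp add: q_def)
qed

section \<open>Residue sequences\<close>

lemma Zp_carrier_mod:
  assumes "x \<in> carrier (Zp p)" "m \<le> M"
  shows "x M mod int p ^ m = x m"
  using assms(2)
proof (induction M rule: dec_induct)
  case base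
  then show ?case using assms(1) by (simp add: Zp_def)
next
  case (step M)
  have "int p ^ m dvd int p ^ M" using step by (simp add: le_imp_power_dvd)
  then have "x (Suc M) mod int p ^ m = x (Suc M) mod int p ^ M mod int p ^ m"
    by (simp add: mod_mod_cancel)
  also have "\<dots> = x M mod int p ^ m"
    using assms(1) by (simp add: Zp_def)
  finally show ?case using step.IH by simp
qed

lemma Zp_carrier_cong:
  "x \<in> carrier (Zp p) \<Longrightarrow> m \<le> M \<Longrightarrow> [x M = x m] (mod int p ^ m)"
  using Zp_carrier_mod[of x p m M] Zp_carrier_mod[of x p m m] by (simp add: cong_def)

lemma Zp_carrier_mod_self [simp]:
  "x \<in> carrier (Zp p) \<Longrightarrow> x m mod int p ^ m = x m"
  by (rule Zp_carrier_mod) auto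

lemma Zp_carrier_mod_prime:
  "x \<in> carrier (Zp p) \<Longrightarrow> x 1 mod int p = x 1"
  using Zp_carrier_mod_self[of x p 1] by simp

lemma Zp_cong_1:
  assumes "x \<in> carrier (Zp p)" "m \<ge> 1"
  shows "[x m = x 1] (mod int p)"
  using Zp_carrier_cong[OF assms] by simp

lemma Zp_carrierI:
  assumes "p > 0" and "\<And>m. [h (Suc m) = h m] (mod int p ^ m)"
  shows "(\<lambda>m. h m mod int p ^ m) \<in> carrier (Zp p)"
proof -
  have "h (Suc m) mod int p ^ Suc m mod int p ^ m = h (Suc m) mod int p ^ m" for m
    by (rule mod_mod_cancel) simp
  then show ?thesis
    using assms by (simp add: Zp_def cong_def del: power_Suc)
qed

lemma Zp_eqI:
  assumes "x \<in> carrier (Zp p)" "y \<in> carrier (Zp p)" and "\<And>m. [x m = y m] (mod int p ^ m)"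
  shows "x = y"
  using assms by (auto simp: fun_eq_iff cong_def)

lemma Zp_mult_apply: "(x \<otimes>\<^bsub>Zp p\<^esub> y) m = x m * y m mod int p ^ m"
  and Zp_add_apply: "(x \<oplus>\<^bsub>Zp p\<^esub> y) m = (x m + y m) mod int p ^ m"
  and Zp_one_apply: "\<one>\<^bsub>Zp p\<^esub> m = 1 mod int p ^ m"
  and Zp_zero_apply: "\<zero>\<^bsub>Zp p\<^esub> m = 0"
  by (simp_all add: Zp_def)

lemma Zp_pow_apply: "(x [^]\<^bsub>Zp p\<^esub> (k::nat)) m = x m ^ k mod int p ^ m"
  by (induction k) (simp_all add: nat_pow_def Zp_mult_apply Zp_one_apply mod_simps mult.commute)

lemma Zp_of_nat_apply: "Zp_of_nat p k m = int k mod int p ^ m"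
  by (induction k)
    (simp_all add: Zp_of_nat_def add_pow_def nat_pow_def Zp_add_apply Zp_zero_apply Zp_one_apply mod_simps add.commute)

lemma Zp_minus_apply:
  assumes p: "p > 0" and x: "x \<in> carrier (Zp p)" and y: "y \<in> carrier (Zp p)"
  shows "(x \<ominus>\<^bsub>Zp p\<^esub> y) m = (x m - y m) mod int p ^ m"
proof -
  interpret cring "Zp p" using p by (rule Zp_cring)
  have "(x \<ominus>\<^bsub>Zp p\<^esub> y) \<oplus>\<^bsub>Zp p\<^esub> y = x"
    using x y by algebra
  then have "[(x \<ominus>\<^bsub>Zp p\<^esub> y) m + y m = x m] (mod int p ^ m)"
    using x by (metis Zp_add_apply Zp_carrier_mod_self cong_def)
  then have "[(x \<ominus>\<^bsub>Zp p\<^esub> y) m + y m - y m = x m - y m] (mod int p ^ m)"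
    by (rule cong_diff) simp
  moreover have "x \<ominus>\<^bsub>Zp p\<^esub> y \<in> carrier (Zp p)" using x y by simp
  ultimately show ?thesis
    by (simp add: cong_def)
qed

lemma Zp_finsum_apply:
  assumes p: "p > 0" and f: "\<And>k. f k \<in> carrier (Zp p)"
  shows "(\<Oplus>\<^bsub>Zp p\<^esub>k\<in>{..<N::nat}. f k) m = (\<Sum>k<N. f k m) mod int p ^ m"
proof -
  interpret cring "Zp p" using p by (rule Zp_cring)
  show ?thesis
  proof (induction N)
    case (Suc N)
    have "(\<Oplus>\<^bsub>Zp p\<^esub>k\<in>{..<Suc N}. f k) = f N \<oplus>\<^bsub>Zp p\<^esub> (\<Oplus>\<^bsub>Zp p\<^esub>k\<in>{..<N}. f k)"
      unfolding lessThan_Suc using f by (subst finsum_insert) auto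
    then show ?case
      using Suc by (simp add: Zp_add_apply mod_simps add.commute)
  qed (simp add: Zp_zero_apply)
qed

text \<open>Write \<open>d = p ^ v * d'\<close>. The residue of the quotient modulo \<open>p ^ m\<close> is obtained from the residue of \<open>a\<close>
  modulo \<open>p ^ (m + v)\<close>, which is divisible by \<open>p ^ v\<close>, and an inverse of \<open>d'\<close> modulo \<open>p ^ m\<close>.\<close>

lemma Zp_nat_quotient_exists:
  assumes p: "prime p" and a: "a \<in> carrier (Zp p)" and d: "d > 0" "a (multiplicity p d) = 0"
  obtains c where "c \<in> carrier (Zp p)" "Zp_of_nat p d \<otimes>\<^bsub>Zp p\<^esub> c = a"
proof -
  define v where "v = multiplicity p d"
  have p0: "p > 0" using p by (rule prime_gt_0_nat)
  obtain d' where d': "d = p ^ v * d'" "\<not> p dvd d'"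
    unfolding v_def by (rule multiplicity_decompose'[of d p]) (use p d in auto)
  have cop: "coprime (int d') (int p ^ m)" for m
    using prime_imp_coprime[OF p d'(2)] by (simp add: coprime_commute)
  have "\<exists>g. \<forall>m. [int d' * g m = 1] (mod int p ^ m)"
    using cong_solve_coprime_int[OF cop] by metis
  then obtain g where g: "[int d' * g m = 1] (mod int p ^ m)" for m by blast
  have "int p ^ v dvd a (m + v)" for m
    using Zp_carrier_mod[OF a, of v "m + v"] d(2) by (simp add: v_def dvd_eq_mod_eq_0)
  then have "\<exists>b. \<forall>m. a (m + v) = int p ^ v * b m"
    unfolding dvd_def by metis
  then obtain b where b: "a (m + v) = int p ^ v * b m" for m by blast
  define c where "c m = b m * g m mod int p ^ m" for m
  have db: "[int d' * (b m * g m) = b m] (mod int p ^ m)" for m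
    using cong_scalar_left[OF g[of m], of "b m"] by (simp add: mult_ac)
  have c_carrier: "c \<in> carrier (Zp p)"
    unfolding c_def
  proof (rule Zp_carrierI[OF p0])
    fix m
    have "[int p ^ v * b (Suc m) = int p ^ v * b m] (mod int p ^ v * int p ^ m)"
      using Zp_carrier_cong[OF a, of "m + v" "Suc m + v"] b[of m] b[of "Suc m"]
      by (simp add: power_add mult.commute)
    then have "[b (Suc m) = b m] (mod int p ^ m)"
      using p0 by (simp add: cong_iff_dvd_diff flip: right_diff_distrib)
    then have "[int d' * (b (Suc m) * g (Suc m)) = int d' * (b m * g m)] (mod int p ^ m)"
      using db[of m] cong_dvd_modulus[OF db[of "Suc m"], of "int p ^ m"]
      by (meson cong_sym cong_trans dvd_triv_right power_Suc dvd_power_le le_imp_power_dvd le_SucI order_refl)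
    then show "[b (Suc m) * g (Suc m) = b m * g m] (mod int p ^ m)"
      using cop by (simp add: cong_mult_lcancel)
  qed
  moreover have "Zp_of_nat p d \<otimes>\<^bsub>Zp p\<^esub> c = a"
  proof
    fix m
    have "[int d * (b m * g m) = int p ^ v * b m] (mod int p ^ m)"
      using cong_scalar_left[OF db[of m], of "int p ^ v"] by (simp add: d'(1) mult_ac)
    also have "[int p ^ v * b m = a m] (mod int p ^ m)"
      using Zp_carrier_cong[OF a, of m "m + v"] b[of m] by simp
    finally have "(int d * (b m * g m)) mod int p ^ m = a m"
      using a by (simp add: cong_def)
    then show "(Zp_of_nat p d \<otimes>\<^bsub>Zp p\<^esub> c) m = a m"
      by (simp add: Zp_mult_apply Zp_of_nat_apply c_def mod_simps)
  qed
  ultimately show ?thesis using that by blast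
qed

lemma Zp_nat_mult_cancel:
  assumes p: "prime p" and c: "c \<in> carrier (Zp p)" and d: "d > 0"
    and eq: "[int d * c (m + multiplicity p d) = 0] (mod int p ^ (m + multiplicity p d))"
  shows "c m = 0"
proof -
  define v where "v = multiplicity p d"
  have p0: "p > 0" using p by (rule prime_gt_0_nat)
  obtain d' where d': "d = p ^ v * d'" "\<not> p dvd d'"
    unfolding v_def by (rule multiplicity_decompose'[of d p]) (use p d in auto)
  have cop: "coprime (int p ^ m) (int d')"
    using d'(2) p by (simp add: prime_imp_coprime)
  have "int p ^ v * int p ^ m dvd int p ^ v * (int d' * c (m + v))"
    using eq unfolding v_def[symmetric] by (simp add: cong_0_iff d'(1) power_add mult_ac)
  then have "int p ^ m dvd c (m + v)"
    using p0 cop by (simp add: coprime_dvd_mult_right_iff)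
  then show ?thesis
    using Zp_carrier_mod[OF c, of m "m + v"] by simp
qed

lemma Zp_div_nat:
  assumes p: "prime p" and a: "a \<in> carrier (Zp p)" and d: "d > 0" "a (multiplicity p d) = 0"
  shows "Zp_div_nat p a d \<in> carrier (Zp p)" and "Zp_of_nat p d \<otimes>\<^bsub>Zp p\<^esub> Zp_div_nat p a d = a"
proof -
  obtain c where c: "c \<in> carrier (Zp p)" "Zp_of_nat p d \<otimes>\<^bsub>Zp p\<^esub> c = a"
    using Zp_nat_quotient_exists[OF assms] .
  interpret cring "Zp p" using p by (simp add: Zp_cring prime_gt_0_nat)
  have p0: "p > 0" using p by (rule prime_gt_0_nat)
  have uniq: "c' = c" if c': "c' \<in> carrier (Zp p)" "Zp_of_nat p d \<otimes>\<^bsub>Zp p\<^esub> c' = a" for c'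
  proof (rule Zp_eqI[OF c'(1) c(1)])
    fix m
    have diff: "c' \<ominus>\<^bsub>Zp p\<^esub> c \<in> carrier (Zp p)" using c c' by simp
    have "[int d * c' M = int d * c M] (mod int p ^ M)" for M
      using fun_cong[OF trans[OF c'(2) c(2)[symmetric]], of M]
      by (simp add: Zp_mult_apply Zp_of_nat_apply mod_simps cong_def)
    then have "[int d * (c' \<ominus>\<^bsub>Zp p\<^esub> c) M = 0] (mod int p ^ M)" for M
      using p0 c c' by (simp add: Zp_minus_apply cong_def mod_simps right_diff_distrib)
        (simp add: cong_iff_dvd_diff flip: cong_def)
    then have "(c' \<ominus>\<^bsub>Zp p\<^esub> c) m = 0"
      using Zp_nat_mult_cancel[OF p diff d(1)] by blast
    then show "[c' m = c m] (mod int p ^ m)"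
      using p0 c c' by (simp add: Zp_minus_apply cong_iff_dvd_diff dvd_eq_mod_eq_0)
  qed
  have "Zp_div_nat p a d = c"
    unfolding Zp_div_nat_def using c uniq by blast
  then show "Zp_div_nat p a d \<in> carrier (Zp p)" "Zp_of_nat p d \<otimes>\<^bsub>Zp p\<^esub> Zp_div_nat p a d = a"
    using c by simp_all
qed

lemma Zp_prime_power_divides_iff:
  assumes p: "prime p" and x: "x \<in> carrier (Zp p)"
  shows "(Zp_of_nat p p [^]\<^bsub>Zp p\<^esub> m) divides\<^bsub>Zp p\<^esub> x \<longleftrightarrow> x m = 0"
proof
  have pm: "(Zp_of_nat p p [^]\<^bsub>Zp p\<^esub> m) = Zp_of_nat p (p ^ m)"
    by (simp add: fun_eq_iff Zp_pow_apply Zp_of_nat_apply mod_simps power_mod)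
  show "x m = 0" if "(Zp_of_nat p p [^]\<^bsub>Zp p\<^esub> m) divides\<^bsub>Zp p\<^esub> x"
    using that unfolding pm by (auto simp: factor_def Zp_mult_apply Zp_of_nat_apply)
  have "multiplicity p (p ^ m) = m"
    using p by (simp add: multiplicity_same_power prime_gt_0_nat)
  then show "(Zp_of_nat p p [^]\<^bsub>Zp p\<^esub> m) divides\<^bsub>Zp p\<^esub> x" if "x m = 0"
    using Zp_nat_quotient_exists[OF p x, of "p ^ m"] that p unfolding pm factor_def
    by (metis prime_gt_0_nat zero_less_power)
qed

lemma Zp_prime_divides_iff:
  assumes "prime p" "x \<in> carrier (Zp p)"
  shows "Zp_of_nat p p divides\<^bsub>Zp p\<^esub> x \<longleftrightarrow> x 1 = 0"
proof -
  interpret cring "Zp p" using assms by (simp add: Zp_cring prime_gt_0_nat)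
  have "Zp_of_nat p p \<in> carrier (Zp p)"
    unfolding Zp_of_nat_def by simp
  then show ?thesis
    using Zp_prime_power_divides_iff[OF assms, of 1] by simp
qed

lemma Zp_tendsto_iff:
  assumes p: "prime p" and s: "\<And>i. s i \<in> carrier (Zp p)" and l: "l \<in> carrier (Zp p)"
  shows "Zp_tendsto p s l \<longleftrightarrow> (\<forall>m. \<forall>\<^sub>F i in sequentially. s i m = l m)"
proof -
  interpret cring "Zp p" using p by (simp add: Zp_cring prime_gt_0_nat)
  have "(s i \<ominus>\<^bsub>Zp p\<^esub> l) m = 0 \<longleftrightarrow> s i m = l m" for i m
    using p s l by (simp add: Zp_minus_apply prime_gt_0_nat flip: mod_eq_dvd_iff dvd_eq_mod_eq_0)
  then show ?thesis
    unfolding Zp_tendsto_def using s l p by (subst Zp_prime_power_divides_iff) auto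
qed

lemma Zp_suminf_eqI:
  assumes p: "prime p" and f: "\<And>k. f k \<in> carrier (Zp p)" and l: "l \<in> carrier (Zp p)"
    and lim: "\<And>m. \<forall>\<^sub>F N in sequentially. [(\<Sum>k<N. f k m) = l m] (mod int p ^ m)"
  shows "Zp_suminf p f = l"
proof -
  interpret cring "Zp p" using p by (simp add: Zp_cring prime_gt_0_nat)
  define s where "s N = (\<Oplus>\<^bsub>Zp p\<^esub>k\<in>{..<N}. f k)" for N
  have s: "s N \<in> carrier (Zp p)" for N
    unfolding s_def using f by (intro finsum_closed) auto
  have sm: "s N m = (\<Sum>k<N. f k m) mod int p ^ m" for N m
    unfolding s_def using p f by (intro Zp_finsum_apply) (auto simp: prime_gt_0_nat)
  have tendsto: "Zp_tendsto p s l' \<longleftrightarrow> (\<forall>m. \<forall>\<^sub>F N in sequentially. [(\<Sum>k<N. f k m) = l' m] (mod int p ^ m))"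
    if "l' \<in> carrier (Zp p)" for l'
    unfolding Zp_tendsto_iff[OF p s that] sm cong_def using that by simp
  show ?thesis
    unfolding Zp_suminf_def s_def[symmetric]
  proof (rule the_equality)
    show "l \<in> carrier (Zp p) \<and> Zp_tendsto p s l"
      using l lim tendsto by blast
    fix l' assume l': "l' \<in> carrier (Zp p) \<and> Zp_tendsto p s l'"
    show "l' = l"
    proof (rule Zp_eqI)
      fix m
      have "\<forall>\<^sub>F N in sequentially. [(\<Sum>k<N. f k m) = l' m] (mod int p ^ m)"
        using l' tendsto by blast
      with lim[of m] have "\<forall>\<^sub>F N::nat in sequentially. [l' m = l m] (mod int p ^ m)"
        by eventually_elim (meson cong_sym cong_trans)
      then show "[l' m = l m] (mod int p ^ m)" by simp
    qed (use l l' in auto)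
  qed
qed

text \<open>The series converges because its \<open>k\<close>-th term is divisible by \<open>p\<close> at least \<open>k / 2\<close> times:
  \<open>a k\<close> is divisible by \<open>p ^ k\<close>, and the division by \<open>d k\<close> loses at most half of these
  factors. Modulo \<open>p ^ m\<close> the sum therefore equals any partial sum with \<open>N \<ge> 2 * m\<close> terms, and this
  in turn can be computed with rational numbers from representatives \<open>b k\<close> of the numerators
  modulo a sufficiently high power of \<open>p\<close>.\<close>

lemma Zp_suminf_div_nat:
  assumes p: "prime p" and a: "\<And>k. a k \<in> carrier (Zp p)" "\<And>k. a k k = 0"
    and d: "\<And>k. d k > 0" "\<And>k. multiplicity p (d k) \<le> k div 2"
  defines "S \<equiv> Zp_suminf p (\<lambda>k. Zp_div_nat p (a k) (d k))"
  shows "S \<in> carrier (Zp p)"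
    and "N \<ge> 2 * m \<Longrightarrow> M \<ge> m + N \<Longrightarrow> (\<And>k. [b k = a k M] (mod int p ^ M)) \<Longrightarrow>
      of_int (S m) - (\<Sum>k<N. of_int (b k) / of_nat (d k)) \<in> localization_ideal p m"
proof -
  define c where "c k = Zp_div_nat p (a k) (d k)" for k
  have p0: "p > 0" using p by (rule prime_gt_0_nat)
  have a0: "a k m = 0" if "m \<le> k" for k m
    using Zp_carrier_mod[OF a(1), of m k k] that a(2) by simp
  have c: "c k \<in> carrier (Zp p)" "Zp_of_nat p (d k) \<otimes>\<^bsub>Zp p\<^esub> c k = a k" for k
    unfolding c_def using Zp_div_nat[OF p a(1) d(1), of k k] a0[of "multiplicity p (d k)" k] d(2)[of k]
    by auto
  have dc: "[int (d k) * c k M = a k M] (mod int p ^ M)" for k M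
  proof -
    have "int (d k) * c k M mod int p ^ M = a k M"
      using fun_cong[OF c(2)[of k], of M] by (simp add: Zp_mult_apply Zp_of_nat_apply mod_simps)
    then show ?thesis
      using a(1) by (simp add: cong_def)
  qed
  have c0: "c k m = 0" if "2 * m \<le> k" for k m
  proof (rule Zp_nat_mult_cancel[OF p c(1) d(1)[of k]])
    have "m + multiplicity p (d k) \<le> k" using that d(2)[of k] by linarith
    then show "[int (d k) * c k (m + multiplicity p (d k)) = 0] (mod int p ^ (m + multiplicity p (d k)))"
      using dc[of k "m + multiplicity p (d k)"] a0 by simp
  qed
  have tail: "(\<Sum>k<N. c k m) = (\<Sum>k<2 * m. c k m)" if "2 * m \<le> N" for N m
    using that c0 by (intro sum.mono_neutral_right) auto
  define l where "l m = (\<Sum>k<2 * m. c k m) mod int p ^ m" for m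
  have l: "l \<in> carrier (Zp p)"
    unfolding l_def
  proof (rule Zp_carrierI[OF p0])
    fix m
    have "[(\<Sum>k<2 * Suc m. c k (Suc m)) = (\<Sum>k<2 * Suc m. c k m)] (mod int p ^ m)"
      by (intro cong_sum Zp_carrier_cong[OF c(1)]) simp
    moreover have "(\<Sum>k<2 * Suc m. c k m) = (\<Sum>k<2 * m. c k m)"
      by (rule tail) simp
    ultimately show "[(\<Sum>k<2 * Suc m. c k (Suc m)) = (\<Sum>k<2 * m. c k m)] (mod int p ^ m)"
      by (simp only:)
  qed
  have S: "S = l"
    unfolding S_def c_def[symmetric]
  proof (rule Zp_suminf_eqI[OF p c(1) l])
    fix m
    show "\<forall>\<^sub>F N in sequentially. [(\<Sum>k<N. c k m) = l m] (mod int p ^ m)"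
    proof (rule eventually_sequentiallyI)
      fix N assume "2 * m \<le> N"
      from tail[OF this] show "[(\<Sum>k<N. c k m) = l m] (mod int p ^ m)"
        by (simp only: l_def cong_def mod_mod_trivial)
    qed
  qed
  show "S \<in> carrier (Zp p)" unfolding S by (rule l)
  assume N: "N \<ge> 2 * m" and M: "M \<ge> m + N"
    and b: "\<And>k. [b k = a k M] (mod int p ^ M)"
  have "int p ^ m dvd S m - (\<Sum>k<N. c k m)"
    unfolding S l_def tail[OF N] by (simp flip: cong_iff_dvd_diff)
  then have 1: "of_int (S m - (\<Sum>k<N. c k m)) \<in> localization_ideal p m"
    by (rule localization_ideal_of_int)
  have "(\<Sum>k<N. of_int (c k m) - of_int (b k) / of_nat (d k)) \<in> localization_ideal p m"
  proof (rule localization_ideal_sum)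
    fix k assume "k \<in> {..<N}"
    then have k: "m + multiplicity p (d k) \<le> M" using M d(2)[of k] by (simp; linarith)
    have "int p ^ M dvd int (d k) * c k M - b k"
      using cong_trans[OF dc cong_sym[OF b]] by (simp add: cong_iff_dvd_diff)
    then have "of_int (int (d k) * c k M - b k) \<in> localization_ideal p M"
      by (rule localization_ideal_of_int)
    then have "of_int (int (d k) * c k M - b k) / of_nat (d k) \<in> localization_ideal p m"
      by (rule localization_ideal_divide[OF p localization_ideal_mono[OF _ k] d(1)])
    moreover have "of_int (c k m - c k M) \<in> localization_ideal p m"
    proof -
      have "[c k m = c k M] (mod int p ^ m)"
        using M by (intro cong_sym[OF Zp_carrier_cong] c(1)) simp
      then show ?thesis
        unfolding cong_iff_dvd_diff by (rule localization_ideal_of_int)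
    qed
    ultimately have "of_int (int (d k) * c k M - b k) / of_nat (d k) + of_int (c k m - c k M) \<in> localization_ideal p m"
      by (rule localization_ideal_add)
    moreover have "of_int (int (d k) * c k M - b k) / of_nat (d k) + of_int (c k m - c k M)
        = (of_int (c k m) - of_int (b k) / of_nat (d k) :: rat)"
      using d(1)[of k] by (simp add: field_simps)
    ultimately show "of_int (c k m) - of_int (b k) / of_nat (d k) \<in> localization_ideal p m"
      by (simp only:)
  qed
  from localization_ideal_add[OF 1 this]
  show "of_int (S m) - (\<Sum>k<N. of_int (b k) / of_nat (d k)) \<in> localization_ideal p m"
    by (simp add: sum_subtractf)
qed

section \<open>Exponential and logarithm of p-adic integers\<close>

text \<open>By the functional equation \<open>exp y ^ q = exp (q * y)\<close> for \<open>q = p ^ m\<close>, and from the quadratic term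
  on the series for \<open>exp (q * y)\<close> vanishes modulo \<open>q ^ 2\<close>.\<close>

lemma Zp_exp_cong:
  assumes p: "prime p" "p \<noteq> 2" and y: "y \<in> carrier (Zp p)" "y 1 = 0"
  shows "Zp_exp p y \<in> carrier (Zp p)"
    and "[Zp_exp p y (2 * m) ^ (p ^ m) = 1 + int p ^ m * y (2 * m)] (mod int p ^ (2 * m))"
proof -
  interpret cring "Zp p" using p(1) by (simp add: Zp_cring prime_gt_0_nat)
  have dvd: "int p dvd y M" if "M \<ge> 1" for M
    using Zp_cong_1[OF y(1) that] y(2) by (simp add: cong_0_iff)
  have a0: "(y [^]\<^bsub>Zp p\<^esub> k) k = 0" for k
    using dvd[of k] by (cases "k = 0") (simp_all add: Zp_pow_apply Zp_one_apply dvd_power_same)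
  have mult: "multiplicity p (fact k) \<le> k div 2" for k
    using multiplicity_fact_le[OF p, of k] by linarith
  note series = Zp_suminf_div_nat[OF p(1) _ a0 fact_gt_zero mult, OF nat_pow_closed[OF y(1)], folded Zp_exp_def]
  show "Zp_exp p y \<in> carrier (Zp p)" by (rule series)
  show "[Zp_exp p y (2 * m) ^ (p ^ m) = 1 + int p ^ m * y (2 * m)] (mod int p ^ (2 * m))"
  proof (cases "m = 0")
    case False
    \<comment> \<open>\<open>N\<close> terms determine the series modulo \<open>p ^ (2 * m)\<close>, and the functional equation of the
      truncation holds modulo \<open>p ^ (N div 2)\<close>; \<open>M\<close> is the precision to which \<open>y\<close> is needed.\<close>
    define N where "N = 4 * m"
    define M where "M = 2 * m + N"
    define Y where "Y = (of_int (y M) :: rat)"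
    define E where "E = (of_int (Zp_exp p y (2 * m)) :: rat)"
    have m: "m \<ge> 1" "N \<ge> 2" "N \<ge> 2 * (2 * m)" "N div 2 = 2 * m" "M \<ge> 1" using False by (auto simp: N_def M_def)
    have Y1: "Y \<in> localization_ideal p 1"
      unfolding Y_def using dvd[of M] m by (intro localization_ideal_of_int) simp
    have "E - (\<Sum>k<N. of_int (y M ^ k) / of_nat (fact k)) \<in> localization_ideal p (2 * m)"
      unfolding E_def by (rule series(2)[where M = M]) (use m in \<open>simp_all add: M_def Zp_pow_apply\<close>)
    then have "E - exp_partial N Y \<in> localization_ideal p (2 * m)"
      by (simp add: exp_partial_def Y_def)
    then have "E ^ (p ^ m) - exp_partial N Y ^ (p ^ m) \<in> localization_ideal p (2 * m)"
      by (rule localization_ideal_power_diff)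
        (use exp_partial_in_localization[OF p Y1, of N] in \<open>auto simp: E_def intro: localization_ideal_of_int\<close>)
    moreover have "exp_partial N Y ^ (p ^ m) - exp_partial N (of_nat (p ^ m) * Y) \<in> localization_ideal p (2 * m)"
      using exp_partial_power[OF p Y1, of N "p ^ m"] m by simp
    moreover have qY: "of_nat (p ^ m) * Y \<in> localization_ideal p m"
      using localization_ideal_of_int[of p m "int p ^ m * y M"] by (simp add: Y_def)
    then have "exp_partial N (of_nat (p ^ m) * Y) - (1 + of_nat (p ^ m) * Y) \<in> localization_ideal p (2 * m)"
      using m by (intro exp_partial_linear p) auto
    moreover have "(1 + of_nat (p ^ m) * Y) - of_int (1 + int p ^ m * y (2 * m)) \<in> localization_ideal p (2 * m)"
    proof -
      have "int p ^ (2 * m) dvd int p ^ m * (y M - y (2 * m))"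
        using Zp_carrier_cong[OF y(1), of "2 * m" M] by (simp add: M_def cong_iff_dvd_diff)
      from localization_ideal_of_int[OF this] show ?thesis
        by (simp add: Y_def algebra_simps)
    qed
    ultimately have "E ^ (p ^ m) - of_int (1 + int p ^ m * y (2 * m)) \<in> localization_ideal p (2 * m)"
      by (blast intro: localization_ideal_trans)
    then have "of_int (Zp_exp p y (2 * m) ^ (p ^ m) - (1 + int p ^ m * y (2 * m))) \<in> localization_ideal p (2 * m)"
      by (simp add: E_def)
    then show ?thesis
      unfolding of_int_in_localization_ideal_iff cong_iff_dvd_diff .
  qed simp
qed

lemma Zp_log_cong:
  assumes p: "prime p" "p \<noteq> 2" and u: "u \<in> carrier (Zp p)" "u 1 = 1"
  shows "Zp_log p u \<in> carrier (Zp p)"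
    and "[u (2 * m) ^ (p ^ m) = 1 + int p ^ m * Zp_log p u (2 * m)] (mod int p ^ (2 * m))"
proof -
  interpret cring "Zp p" using p(1) by (simp add: Zp_cring prime_gt_0_nat)
  have p0: "p > 0" using p(1) by (rule prime_gt_0_nat)
  have dvd: "int p dvd u M - 1" if "M \<ge> 1" for M
    using Zp_cong_1[OF u(1) that] u(2) by (simp add: cong_iff_dvd_diff)
  define a where "a k = (\<ominus>\<^bsub>Zp p\<^esub> \<one>\<^bsub>Zp p\<^esub>) [^]\<^bsub>Zp p\<^esub> k \<otimes>\<^bsub>Zp p\<^esub> (u \<ominus>\<^bsub>Zp p\<^esub> \<one>\<^bsub>Zp p\<^esub>) [^]\<^bsub>Zp p\<^esub> Suc k" for k
  have a: "a k \<in> carrier (Zp p)" for k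
    unfolding a_def using u by simp
  have "(\<ominus>\<^bsub>Zp p\<^esub> \<one>\<^bsub>Zp p\<^esub>) M = (- 1) mod int p ^ M" for M
  proof -
    have "\<ominus>\<^bsub>Zp p\<^esub> \<one>\<^bsub>Zp p\<^esub> = \<zero>\<^bsub>Zp p\<^esub> \<ominus>\<^bsub>Zp p\<^esub> \<one>\<^bsub>Zp p\<^esub>"
      by (simp add: a_minus_def)
    then show ?thesis
      using Zp_minus_apply[OF p0 zero_closed one_closed, of M]
      by (simp add: Zp_zero_apply Zp_one_apply mod_simps)
  qed
  moreover have "(u \<ominus>\<^bsub>Zp p\<^esub> \<one>\<^bsub>Zp p\<^esub>) M = (u M - 1) mod int p ^ M" for M
    using Zp_minus_apply[OF p0 u(1) one_closed, of M] by (simp add: Zp_one_apply mod_simps)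
  ultimately have a_apply: "a k M = ((- 1) ^ k * (u M - 1) ^ Suc k) mod int p ^ M" for k M
    unfolding a_def Zp_mult_apply Zp_pow_apply by (simp only: mod_simps power_mod)
  have a0: "a k k = 0" for k
  proof -
    have "int p ^ k dvd (u k - 1) ^ Suc k"
      using dvd[of k] by (cases "k = 0") (auto intro: dvd_mult dvd_power_same)
    then show ?thesis by (simp add: a_apply del: power_Suc)
  qed
  note series = Zp_suminf_div_nat[OF p(1) a a0 zero_less_Suc multiplicity_Suc_le[OF p],
      unfolded a_def, folded Zp_log_def, folded a_def]
  show "Zp_log p u \<in> carrier (Zp p)" by (rule series)
  show "[u (2 * m) ^ (p ^ m) = 1 + int p ^ m * Zp_log p u (2 * m)] (mod int p ^ (2 * m))"
  proof -
    \<comment> \<open>\<open>4 * m\<close> terms determine the series modulo \<open>p ^ (2 * m)\<close>, and \<open>p ^ m\<close> terms exhaust the binomial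
      expansion of the power \<open>p ^ m\<close>.\<close>
    define N where "N = 4 * m + p ^ m"
    define M where "M = 2 * m + N"
    define t where "t = (of_int (u M - 1) :: rat)"
    define L where "L = (of_int (Zp_log p u (2 * m)) :: rat)"
    have "M \<ge> 1" using p0 by (simp add: M_def N_def Suc_le_eq)
    then have t1: "t \<in> localization_ideal p 1"
      unfolding t_def using dvd[of M] by (intro localization_ideal_of_int) simp
    have "L - (\<Sum>k<N. of_int ((- 1) ^ k * (u M - 1) ^ Suc k) / of_nat (Suc k)) \<in> localization_ideal p (2 * m)"
      unfolding L_def by (rule series(2)[where M = M]) (simp_all add: N_def M_def a_apply del: power_Suc)
    then have "L - log_partial N t \<in> localization_ideal p (2 * m)"
      by (simp add: log_partial_def t_def del: power_Suc of_nat_Suc)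
    then have "of_nat (p ^ m) * (log_partial N t - L) \<in> localization_ideal p (2 * m)"
      using localization_ideal_of_int[of p 0 "int p ^ m"] localization_ideal_minus
      by (intro localization_ideal_mult_left) fastforce+
    moreover have "(1 + t) ^ (p ^ m) - (1 + of_nat (p ^ m) * log_partial N t) \<in> localization_ideal p (2 * m)"
      by (intro one_plus_power_eq_log_partial p t1) (simp add: N_def)
    ultimately have "(1 + t) ^ (p ^ m) - (1 + of_nat (p ^ m) * log_partial N t) + of_nat (p ^ m) * (log_partial N t - L)
        \<in> localization_ideal p (2 * m)"
      by (intro localization_ideal_add)
    then have "of_int (u M ^ (p ^ m) - (1 + int p ^ m * Zp_log p u (2 * m))) \<in> localization_ideal p (2 * m)"
      by (simp add: t_def L_def algebra_simps)
    then have "[u M ^ (p ^ m) = 1 + int p ^ m * Zp_log p u (2 * m)] (mod int p ^ (2 * m))"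
      unfolding of_int_in_localization_ideal_iff cong_iff_dvd_diff .
    moreover have "[u M ^ (p ^ m) = u (2 * m) ^ (p ^ m)] (mod int p ^ (2 * m))"
      by (intro cong_pow Zp_carrier_cong u) (simp add: M_def)
    ultimately show ?thesis
      by (meson cong_sym cong_trans)
  qed
qed
text \<open>One-units have no torsion, in a quantitative form: by lifting the exponent, precision is lost only
  by the multiplicity of \<open>p\<close> in the exponent.\<close>

lemma Zp_one_unit_power_eq_one:
  assumes p: "prime p" "p \<noteq> 2" and u: "u \<in> carrier (Zp p)" "u 1 = 1" and c: "c > 0"
    and eq: "[u (m + multiplicity p c) ^ c = 1] (mod int p ^ (m + multiplicity p c))"
  shows "[u m = 1] (mod int p ^ m)"
proof (cases "m = 0")
  case False
  interpret cring "Zp p" using p(1) by (simp add: Zp_cring prime_gt_0_nat)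
  define M where "M = m + multiplicity p c"
  have minus_one: "(u \<ominus>\<^bsub>Zp p\<^esub> \<one>\<^bsub>Zp p\<^esub>) M = (u M - 1) mod int p ^ M" for M
    using Zp_minus_apply[OF prime_gt_0_nat[OF p(1)] u(1) one_closed, of M]
    by (simp add: Zp_one_apply mod_simps)
  have "[u M = 1] (mod int p)"
    using Zp_cong_1[OF u(1), of M] u(2) False by (simp add: M_def)
  then have "int p ^ M dvd int c * (u M - 1)"
    using lifting_the_exponent[OF p, of "u M" M c] eq by (simp add: M_def cong_iff_dvd_diff)
  then have "[int c * (u \<ominus>\<^bsub>Zp p\<^esub> \<one>\<^bsub>Zp p\<^esub>) M = 0] (mod int p ^ M)"
    by (simp add: minus_one cong_def mod_simps mod_eq_0_iff_dvd)
  then have "(u \<ominus>\<^bsub>Zp p\<^esub> \<one>\<^bsub>Zp p\<^esub>) m = 0"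
    using u(1) by (intro Zp_nat_mult_cancel[OF p(1) _ c]) (simp_all add: M_def)
  then show ?thesis
    by (simp add: minus_one cong_iff_dvd_diff mod_eq_0_iff_dvd)
qed simp

text \<open>Modulo \<open>p\<close>, the case \<open>m = 1\<close> of \<open>Zp_exp_cong\<close> says that the \<open>p\<close>-th power of \<open>exp y\<close> is \<open>1\<close>, and
  by Fermat this power is \<open>exp y\<close> itself.\<close>

lemma Zp_exp_1:
  assumes p: "prime p" "p \<noteq> 2" and y: "y \<in> carrier (Zp p)" "y 1 = 0"
  shows "Zp_exp p y 1 = 1"
proof -
  define a where "a = Zp_exp p y 1"
  have p1: "p > 1" using p(1) by (rule prime_gt_1_nat)
  have a: "0 \<le> a" "a < int p"
    using Zp_exp_cong(1)[OF p y] unfolding a_def by (auto simp: Zp_def dest: spec[of _ 1])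
  have "[Zp_exp p y 2 ^ p = 1 + int p * y 2] (mod int p)"
    using Zp_exp_cong(2)[OF p y, of 1] by (auto intro: cong_dvd_modulus)
  also have "[1 + int p * y 2 = 1] (mod int p)" by (simp add: cong_iff_dvd_diff)
  finally have "[a ^ p = 1] (mod int p)"
    using cong_pow[OF Zp_cong_1[OF Zp_exp_cong(1)[OF p y], of 2], of p] unfolding a_def
    by (auto intro: cong_trans cong_sym)
  moreover from this have "\<not> int p dvd a"
  proof (rule contrapos_pn)
    assume "int p dvd a"
    then have "int p dvd a ^ p" using p1 by (simp add: dvd_power_same dvd_trans[OF _ dvd_power])
    moreover have "\<not> int p dvd 1" using p1 by simp
    ultimately show "\<not> [a ^ p = 1] (mod int p)" using cong_dvd_iff by blast
  qed
  moreover have "a ^ p = a ^ (p - 1) * a"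
    using p1 by (metis Suc_diff_1 less_trans power_Suc2 zero_less_one)
  ultimately have "[1 * a = 1] (mod int p)"
    using cong_mult[OF int_fermat[OF p(1)] cong_refl, of a a] by (metis cong_sym cong_trans)
  then show ?thesis
    using a p1 unfolding a_def[symmetric] by (simp add: cong_def)
qed

text \<open>\<open>Zp_exp_cong\<close> with \<open>y = 0\<close> says that \<open>exp 0\<close> to the power \<open>p ^ m\<close> is \<open>1\<close> modulo \<open>p ^ (2 * m)\<close>, so
  that the one-unit \<open>exp 0\<close> is \<open>1\<close> modulo \<open>p ^ m\<close>.\<close>

lemma Zp_exp_eq_one:
  assumes p: "prime p" "p \<noteq> 2" and y: "y = \<zero>\<^bsub>Zp p\<^esub>"
  shows "Zp_exp p y = \<one>\<^bsub>Zp p\<^esub>"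
proof -
  interpret cring "Zp p" using p(1) by (simp add: Zp_cring prime_gt_0_nat)
  have y': "y \<in> carrier (Zp p)" "y 1 = 0" unfolding y by (simp, simp add: Zp_zero_apply)
  have p0: "p > 0" using p(1) by (rule prime_gt_0_nat)
  show ?thesis
  proof (rule Zp_eqI)
    fix m
    have "multiplicity p (p ^ m) = m" using p(1) by (simp add: multiplicity_same_power p0)
    then have "[Zp_exp p y m = 1] (mod int p ^ m)"
      using Zp_exp_cong(2)[OF p y', of m] p0
      by (intro Zp_one_unit_power_eq_one[OF p Zp_exp_cong(1)[OF p y'] Zp_exp_1[OF p y'], of "p ^ m"])
        (simp_all add: y Zp_zero_apply flip: mult_2)
    then show "[Zp_exp p y m = \<one>\<^bsub>Zp p\<^esub> m] (mod int p ^ m)"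
      by (simp add: Zp_one_apply)
  qed (use Zp_exp_cong(1)[OF p y'] in auto)
qed

lemma Zp_log_eq_zero_iff:
  assumes p: "prime p" "p \<noteq> 2" and u: "u \<in> carrier (Zp p)" "u 1 = 1"
  shows "Zp_log p u = \<zero>\<^bsub>Zp p\<^esub> \<longleftrightarrow> u = \<one>\<^bsub>Zp p\<^esub>"
proof
  interpret cring "Zp p" using p(1) by (simp add: Zp_cring prime_gt_0_nat)
  have p0: "p > 0" using p(1) by (rule prime_gt_0_nat)
  have L: "Zp_log p u \<in> carrier (Zp p)" by (rule Zp_log_cong[OF p u])
  {
    assume 0: "Zp_log p u = \<zero>\<^bsub>Zp p\<^esub>"
    show "u = \<one>\<^bsub>Zp p\<^esub>"
    proof (rule Zp_eqI[OF u(1) one_closed])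
      fix m
      have "multiplicity p (p ^ m) = m" using p(1) by (simp add: multiplicity_same_power p0)
      then have "[u m = 1] (mod int p ^ m)"
        using Zp_log_cong(2)[OF p u, of m] p0
        by (intro Zp_one_unit_power_eq_one[OF p u, of "p ^ m"])
          (simp_all add: 0 Zp_zero_apply flip: mult_2)
      then show "[u m = \<one>\<^bsub>Zp p\<^esub> m] (mod int p ^ m)"
        by (simp add: Zp_one_apply)
    qed
  next
    assume 1: "u = \<one>\<^bsub>Zp p\<^esub>"
    show "Zp_log p u = \<zero>\<^bsub>Zp p\<^esub>"
    proof (rule Zp_eqI[OF L zero_closed])
      fix m
      have "[u (2 * m) ^ (p ^ m) = 1] (mod int p ^ (2 * m))"
        by (simp add: 1 Zp_one_apply cong_def power_mod)
      then have "[1 + int p ^ m * Zp_log p u (2 * m) = 1] (mod int p ^ (2 * m))"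
        using Zp_log_cong(2)[OF p u, of m] by (meson cong_sym cong_trans)
      then have "int p ^ m * int p ^ m dvd int p ^ m * Zp_log p u (2 * m)"
        by (simp add: cong_iff_dvd_diff mult_2 power_add)
      then have "[Zp_log p u (2 * m) = 0] (mod int p ^ m)"
        using p0 by (simp add: cong_0_iff)
      then show "[Zp_log p u m = \<zero>\<^bsub>Zp p\<^esub> m] (mod int p ^ m)"
        using Zp_carrier_cong[OF L, of m "2 * m"] unfolding Zp_zero_apply
        by (metis cong_sym cong_trans le_add1 mult_2)
    qed
  }
qed

text \<open>This is the cancellation law for \<open>(z - 1) * L = 0\<close>. If \<open>L\<close> is not divisible by \<open>p ^ k\<close> and the
  product is divisible by \<open>p ^ (m + k)\<close>, then \<open>z - 1\<close> is divisible by \<open>p ^ m\<close>.\<close>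

lemma Zp_mult_eq_self_imp:
  assumes p: "prime p" and z: "z \<in> carrier (Zp p)" and L: "L \<in> carrier (Zp p)" "L \<noteq> \<zero>\<^bsub>Zp p\<^esub>"
    and eq: "z \<otimes>\<^bsub>Zp p\<^esub> L = L"
  shows "z = \<one>\<^bsub>Zp p\<^esub>"
proof -
  interpret cring "Zp p" using p by (simp add: Zp_cring prime_gt_0_nat)
  obtain k where k: "L k \<noteq> 0"
    using L(2) by (auto simp: fun_eq_iff Zp_zero_apply)
  show ?thesis
  proof (rule Zp_eqI[OF z one_closed])
    fix m
    define M where "M = m + k"
    have unit: "\<not> is_unit (int p)" and pe: "prime_elem (int p)" using p by auto
    have "L M mod int p ^ k = L k" by (rule Zp_carrier_mod[OF L(1)]) (simp add: M_def)
    then have Lk: "\<not> int p ^ k dvd L M" using k by (simp add: dvd_eq_mod_eq_0)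
    have "z M * L M mod int p ^ M = L M mod int p ^ M"
      using fun_cong[OF eq, of M] L(1) by (simp add: Zp_mult_apply)
    then have "int p ^ M dvd z M * L M - L M" by (simp add: mod_eq_dvd_iff)
    then have dvd: "int p ^ M dvd (z M - 1) * L M" by (simp add: algebra_simps)
    have "int p ^ m dvd z M - 1"
    proof (cases "z M - 1 = 0")
      case False
      have "L M \<noteq> 0" using Lk by auto
      then have "M \<le> multiplicity (int p) (z M - 1) + multiplicity (int p) (L M)" "multiplicity (int p) (L M) < k"
        using dvd Lk False unit pe
        by (simp_all add: power_dvd_iff_le_multiplicity prime_elem_multiplicity_mult_distrib)
      then show ?thesis
        using False unit by (simp add: power_dvd_iff_le_multiplicity M_def)
    next
      case True
      then show ?thesis by simp
    qed
    then have "[z M = 1] (mod int p ^ m)" by (simp add: cong_iff_dvd_diff)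
    then show "[z m = \<one>\<^bsub>Zp p\<^esub> m] (mod int p ^ m)"
      using Zp_carrier_cong[OF z, of m M] unfolding Zp_one_apply
      by (simp add: M_def cong_def)
  qed
qed

lemma Zp_log_1:
  assumes p: "prime p" "p \<noteq> 2" and u: "u \<in> carrier (Zp p)" "u 1 = 1"
  shows "Zp_log p u 1 = 0"
proof -
  have p0: "p > 0" using p(1) by (rule prime_gt_0_nat)
  have L: "Zp_log p u \<in> carrier (Zp p)" by (rule Zp_log_cong[OF p u])
  have "[u 2 = 1] (mod int p)" using Zp_cong_1[OF u(1), of 2] u(2) by simp
  then have "[u 2 ^ p = 1] (mod int p ^ 2)"
    using cong_power_prime_power[of "u 2" 1 p 1] by (simp add: numeral_2_eq_2)
  then have "[1 + int p * Zp_log p u 2 = 1] (mod int p ^ 2)"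
    using Zp_log_cong(2)[OF p u, of 1] by (simp; meson cong_sym cong_trans)
  then have "int p * int p dvd int p * Zp_log p u 2"
    by (simp add: cong_iff_dvd_diff power2_eq_square)
  then have "[Zp_log p u 2 = 0] (mod int p)"
    using p0 by (simp add: cong_0_iff)
  then have "[Zp_log p u 1 = 0] (mod int p)"
    using Zp_cong_1[OF L, of 2] by (simp; meson cong_sym cong_trans)
  then show ?thesis
    using Zp_carrier_mod_self[OF L, of 1] by (simp add: cong_def)
qed

lemma Zp_powr_one_unit:
  assumes p: "prime p" "p \<noteq> 2" and u: "u \<in> carrier (Zp p)" "u 1 = 1" and z: "z \<in> carrier (Zp p)"
  shows "Zp_powr p u z \<in> carrier (Zp p)" and "Zp_powr p u z 1 = 1"
proof -
  interpret cring "Zp p" using p(1) by (simp add: Zp_cring prime_gt_0_nat)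
  have y: "z \<otimes>\<^bsub>Zp p\<^esub> Zp_log p u \<in> carrier (Zp p)" "(z \<otimes>\<^bsub>Zp p\<^esub> Zp_log p u) 1 = 0"
    using z Zp_log_cong(1)[OF p u] Zp_log_1[OF p u] by (simp, simp add: Zp_mult_apply)
  show "Zp_powr p u z \<in> carrier (Zp p)" "Zp_powr p u z 1 = 1"
    unfolding Zp_powr_def using Zp_exp_cong(1)[OF p y] Zp_exp_1[OF p y] by blast+
qed

lemma Zp_powr_one_left:
  assumes p: "prime p" "p \<noteq> 2" and z: "z \<in> carrier (Zp p)"
  shows "Zp_powr p \<one>\<^bsub>Zp p\<^esub> z = \<one>\<^bsub>Zp p\<^esub>"
proof -
  interpret cring "Zp p" using p(1) by (simp add: Zp_cring prime_gt_0_nat)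
  have "\<one>\<^bsub>Zp p\<^esub> 1 = 1"
    using prime_gt_1_nat[OF p(1)] by (simp add: Zp_one_apply)
  then have "Zp_log p \<one>\<^bsub>Zp p\<^esub> = \<zero>\<^bsub>Zp p\<^esub>"
    using Zp_log_eq_zero_iff[OF p one_closed] by blast
  then show ?thesis
    unfolding Zp_powr_def using z by (simp add: Zp_exp_eq_one[OF p])
qed

text \<open>Comparing \<open>exp (z * L) ^ q = 1 + q * z * L\<close> with \<open>u ^ q = 1 + q * L\<close> modulo \<open>q ^ 2\<close>, for \<open>L = log u\<close>
  and all \<open>q = p ^ m\<close>, gives \<open>z * L = L\<close>, so that \<open>L = 0\<close> or \<open>z = 1\<close>.\<close>

lemma Zp_powr_eq_base_imp:
  assumes p: "prime p" "p \<noteq> 2" and u: "u \<in> carrier (Zp p)" "u 1 = 1" and z: "z \<in> carrier (Zp p)"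
    and eq: "Zp_powr p u z = u"
  shows "u = \<one>\<^bsub>Zp p\<^esub> \<or> z = \<one>\<^bsub>Zp p\<^esub>"
proof -
  interpret cring "Zp p" using p(1) by (simp add: Zp_cring prime_gt_0_nat)
  have p0: "p > 0" using p(1) by (rule prime_gt_0_nat)
  define L where "L = Zp_log p u"
  define y where "y = z \<otimes>\<^bsub>Zp p\<^esub> L"
  have L: "L \<in> carrier (Zp p)" "L 1 = 0"
    unfolding L_def using Zp_log_cong(1)[OF p u] Zp_log_1[OF p u] .
  have y: "y \<in> carrier (Zp p)" "y 1 = 0"
    using z L by (simp add: y_def, simp add: y_def Zp_mult_apply)
  have exp: "Zp_exp p y = u"
    using eq by (simp add: Zp_powr_def y_def L_def)
  have "y = L"
  proof (rule Zp_eqI[OF y(1) L(1)])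
    fix m
    have "[1 + int p ^ m * y (2 * m) = 1 + int p ^ m * L (2 * m)] (mod int p ^ (2 * m))"
      using Zp_exp_cong(2)[OF p y, of m] Zp_log_cong(2)[OF p u, of m] unfolding exp L_def
      by (meson cong_sym cong_trans)
    then have "int p ^ m * int p ^ m dvd int p ^ m * (y (2 * m) - L (2 * m))"
      by (simp add: cong_iff_dvd_diff mult_2 power_add right_diff_distrib)
    then have "[y (2 * m) = L (2 * m)] (mod int p ^ m)"
      using p0 by (simp add: cong_iff_dvd_diff)
    moreover have "[y (2 * m) = y m] (mod int p ^ m)" "[L (2 * m) = L m] (mod int p ^ m)"
      using y L by (auto intro: Zp_carrier_cong)
    ultimately show "[y m = L m] (mod int p ^ m)"
      by (meson cong_sym cong_trans)
  qed
  then have "L = \<zero>\<^bsub>Zp p\<^esub> \<or> z = \<one>\<^bsub>Zp p\<^esub>"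
    using Zp_mult_eq_self_imp[OF p(1) z L(1)] unfolding y_def by blast
  then show ?thesis
    using Zp_log_eq_zero_iff[OF p u] unfolding L_def by blast
qed

section \<open>Teichmueller representatives and the p-adic equation\<close>

definition Zp_roots_of_unity :: "nat \<Rightarrow> (nat \<Rightarrow> int) set" where
  "Zp_roots_of_unity p = {w \<in> carrier (Zp p). w [^]\<^bsub>Zp p\<^esub> (p - 1) = \<one>\<^bsub>Zp p\<^esub>}"

text \<open>A root of unity \<open>w\<close> satisfies \<open>w = w ^ p ^ m\<close>, and modulo \<open>p ^ (m + 1)\<close> the right-hand side depends
  only on \<open>w\<close> modulo \<open>p\<close>.\<close>

lemma Zp_roots_of_unity_eqI:
  assumes p: "prime p" and w: "w \<in> Zp_roots_of_unity p" "w' \<in> Zp_roots_of_unity p" and eq: "w 1 = w' 1"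
  shows "w = w'"
proof (rule Zp_eqI)
  have p0: "p > 0" using p by (rule prime_gt_0_nat)
  have c: "w \<in> carrier (Zp p)" "w' \<in> carrier (Zp p)" using w by (auto simp: Zp_roots_of_unity_def)
  then show "w \<in> carrier (Zp p)" "w' \<in> carrier (Zp p)" .
  fix m
  have fixed: "[v m ^ p ^ m = v m] (mod int p ^ m)" if "v \<in> Zp_roots_of_unity p" for v
  proof (rule power_prime_power_fixed[OF _ p0])
    have "(v [^]\<^bsub>Zp p\<^esub> (p - 1)) m = \<one>\<^bsub>Zp p\<^esub> m"
      using that by (simp add: Zp_roots_of_unity_def)
    then show "[v m ^ (p - 1) = 1] (mod int p ^ m)"
      by (simp only: Zp_pow_apply Zp_one_apply cong_def)
  qed
  show "[w m = w' m] (mod int p ^ m)"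
  proof (cases "m = 0")
    case False
    then have "[w m = w' m] (mod int p)"
      using Zp_cong_1[OF c(1), of m] Zp_cong_1[OF c(2), of m] eq by (simp add: cong_def)
    then have "[w m ^ p ^ m = w' m ^ p ^ m] (mod int p ^ Suc m)"
      by (rule cong_power_prime_power)
    then have "[w m ^ p ^ m = w' m ^ p ^ m] (mod int p ^ m)"
      by (rule cong_dvd_modulus) simp
    then show ?thesis
      using fixed[OF w(1)] fixed[OF w(2)] by (meson cong_sym cong_trans)
  qed simp
qed

lemma Zp_roots_of_unity_pow:
  assumes p: "prime p" and w: "w \<in> Zp_roots_of_unity p"
  shows "w [^]\<^bsub>Zp p\<^esub> (k::nat) \<in> Zp_roots_of_unity p"
proof -
  interpret cring "Zp p" using p by (simp add: Zp_cring prime_gt_0_nat)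
  have c: "w \<in> carrier (Zp p)" "w [^]\<^bsub>Zp p\<^esub> (p - 1) = \<one>\<^bsub>Zp p\<^esub>"
    using w by (auto simp: Zp_roots_of_unity_def)
  have "(w [^]\<^bsub>Zp p\<^esub> k) [^]\<^bsub>Zp p\<^esub> (p - 1) = (w [^]\<^bsub>Zp p\<^esub> (p - 1)) [^]\<^bsub>Zp p\<^esub> k"
    using c(1) by (simp add: nat_pow_pow mult.commute)
  then show ?thesis
    using c by (simp add: Zp_roots_of_unity_def)
qed

lemma Zp_root_of_unity_residue:
  assumes p: "prime p" and w: "w \<in> Zp_roots_of_unity p"
  shows "w 1 \<noteq> 0"
proof
  assume "w 1 = 0"
  have "p > 1" using p by (rule prime_gt_1_nat)
  moreover from this have "(w [^]\<^bsub>Zp p\<^esub> (p - 1)) 1 = 1"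
    using w by (simp add: Zp_roots_of_unity_def Zp_one_apply)
  ultimately show False using \<open>w 1 = 0\<close> by (simp add: Zp_pow_apply zero_power)
qed

text \<open>The limit of the powers \<open>x ^ p ^ m\<close>, with the \<open>m\<close>-th power giving the residue modulo \<open>p ^ m\<close>.\<close>

lemma Zp_root_of_unity_exists:
  assumes p: "prime p" and x: "x \<in> carrier (Zp p)" "x 1 \<noteq> 0"
  obtains w where "w \<in> Zp_roots_of_unity p" "w 1 = x 1"
proof -
  have p0: "p > 0" using p by (rule prime_gt_0_nat)
  have x1: "x 1 mod int p = x 1" using Zp_carrier_mod_self[OF x(1), of 1] by simp
  then have ndvd: "\<not> int p dvd x 1" using x(2) by (simp add: dvd_eq_mod_eq_0)
  define w where "w m = x 1 ^ p ^ m mod int p ^ m" for m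
  have fermat: "[x 1 ^ (p - 1) = 1] (mod int p)"
    using p ndvd by (rule int_fermat)
  have w: "w \<in> carrier (Zp p)"
    unfolding w_def
  proof (rule Zp_carrierI[OF p0])
    fix m
    have "[x 1 ^ p = x 1] (mod int p)"
      using power_prime_power_fixed[OF fermat p0, of 1] by simp
    then have "[(x 1 ^ p) ^ p ^ m = x 1 ^ p ^ m] (mod int p ^ Suc m)"
      by (rule cong_power_prime_power)
    then have "[(x 1 ^ p) ^ p ^ m = x 1 ^ p ^ m] (mod int p ^ m)"
      by (rule cong_dvd_modulus) simp
    then show "[x 1 ^ p ^ Suc m = x 1 ^ p ^ m] (mod int p ^ m)"
      by (simp flip: power_mult)
  qed
  moreover have "w [^]\<^bsub>Zp p\<^esub> (p - 1) = \<one>\<^bsub>Zp p\<^esub>"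
  proof
    fix m
    have "[(x 1 ^ (p - 1)) ^ p ^ m = 1 ^ p ^ m] (mod int p ^ Suc m)"
      by (rule cong_power_prime_power[OF fermat])
    then have "[(x 1 ^ (p - 1)) ^ p ^ m = 1 ^ p ^ m] (mod int p ^ m)"
      by (rule cong_dvd_modulus) simp
    then have "(x 1 ^ p ^ m) ^ (p - 1) mod int p ^ m = 1 mod int p ^ m"
      by (simp add: cong_def mult.commute flip: power_mult)
    then show "(w [^]\<^bsub>Zp p\<^esub> (p - 1)) m = \<one>\<^bsub>Zp p\<^esub> m"
      by (simp add: Zp_pow_apply Zp_one_apply w_def power_mod)
  qed
  moreover have "w 1 = x 1"
    using power_prime_power_fixed[OF fermat p0, of 1] x1 by (simp add: w_def cong_def)
  ultimately show ?thesis
    using that by (simp add: Zp_roots_of_unity_def)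
qed

lemma teichmuller_eq_iff:
  assumes p: "prime p" and x: "x \<in> carrier (Zp p)" "x 1 \<noteq> 0"
  shows "teichmuller p x = w \<longleftrightarrow> w \<in> Zp_roots_of_unity p \<and> w 1 = x 1"
proof -
  interpret cring "Zp p" using p by (simp add: Zp_cring prime_gt_0_nat)
  have p0: "p > 0" using p by (rule prime_gt_0_nat)
  obtain w0 where w0: "w0 \<in> Zp_roots_of_unity p" "w0 1 = x 1"
    using Zp_root_of_unity_exists[OF assms] .
  have div: "Zp_of_nat p p divides\<^bsub>Zp p\<^esub> (v \<ominus>\<^bsub>Zp p\<^esub> x) \<longleftrightarrow> v 1 = x 1" if v: "v \<in> carrier (Zp p)" for v
  proof -
    have "Zp_of_nat p p divides\<^bsub>Zp p\<^esub> (v \<ominus>\<^bsub>Zp p\<^esub> x) \<longleftrightarrow> (v 1 - x 1) mod int p ^ 1 = 0"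
      using v x by (subst Zp_prime_divides_iff[OF p]) (simp_all add: Zp_minus_apply[OF p0])
    also have "\<dots> \<longleftrightarrow> v 1 mod int p ^ 1 = x 1 mod int p ^ 1"
      by (simp add: mod_eq_dvd_iff dvd_eq_mod_eq_0)
    also have "\<dots> \<longleftrightarrow> v 1 = x 1"
      using v x by (simp only: Zp_carrier_mod_self)
    finally show ?thesis .
  qed
  have "teichmuller p x = w0"
    unfolding teichmuller_def
  proof (rule the_equality)
    show "w0 \<in> carrier (Zp p) \<and> w0 [^]\<^bsub>Zp p\<^esub> (p - 1) = \<one>\<^bsub>Zp p\<^esub> \<and>
        Zp_of_nat p p divides\<^bsub>Zp p\<^esub> (w0 \<ominus>\<^bsub>Zp p\<^esub> x)"
      using w0 div by (simp add: Zp_roots_of_unity_def)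
    fix v assume "v \<in> carrier (Zp p) \<and> v [^]\<^bsub>Zp p\<^esub> (p - 1) = \<one>\<^bsub>Zp p\<^esub> \<and>
        Zp_of_nat p p divides\<^bsub>Zp p\<^esub> (v \<ominus>\<^bsub>Zp p\<^esub> x)"
    then have "v \<in> Zp_roots_of_unity p" "v 1 = x 1"
      using div by (auto simp: Zp_roots_of_unity_def)
    then show "v = w0" using w0 by (intro Zp_roots_of_unity_eqI[OF p]) simp_all
  qed
  then show ?thesis
    using w0 Zp_roots_of_unity_eqI[OF p] by metis
qed

text \<open>For a root of unity \<open>x\<close> the one-unit part is \<open>1\<close> and the equation reduces to \<open>x ^ (x0 ^ n) = x\<close>.
  Conversely let \<open>x = w * u\<close> be the decomposition of a solution and \<open>E\<close> the value of the power of \<open>u\<close>.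
  As \<open>E\<close> and \<open>u\<close> are \<open>1\<close> modulo \<open>p\<close>, the roots of unity \<open>w ^ (x0 ^ n)\<close> and \<open>w\<close> have the same residue and
  hence are equal, which leaves \<open>E = u\<close>. Then \<open>u = 1\<close> or \<open>x ^ n = 1\<close>, and in the second case the same
  comparison of residues gives \<open>w ^ n = 1\<close> and \<open>u ^ n = 1\<close>.\<close>

lemma Zp_solutions_eq:
  assumes p: "prime p" "p \<noteq> 2" and n: "n > 0"
  shows "Zp_solutions p n = {(x, x0). x \<in> Zp_roots_of_unity p \<and> x0 \<in> {1..p - 1} \<and> x [^]\<^bsub>Zp p\<^esub> (x0 ^ n) = x}"
proof -
  interpret cring "Zp p" using p by (simp add: Zp_cring prime_gt_0_nat)
  have p0: "p > 0" and p1: "p > 1" using prime_gt_1_nat[OF p(1)] by simp_all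
  have one1: "\<one>\<^bsub>Zp p\<^esub> 1 = 1" using p1 by (simp add: Zp_one_apply)
  have root_unit: "w \<in> Units (Zp p)" if "w \<in> Zp_roots_of_unity p" for w
  proof -
    have w: "w \<in> carrier (Zp p)" "w [^]\<^bsub>Zp p\<^esub> (p - 1) = \<one>\<^bsub>Zp p\<^esub>"
      using that by (auto simp: Zp_roots_of_unity_def)
    have "Suc (p - 2) = p - 1" using p1 by simp
    then have "w [^]\<^bsub>Zp p\<^esub> (p - 2) \<otimes>\<^bsub>Zp p\<^esub> w = \<one>\<^bsub>Zp p\<^esub>"
      using w nat_pow_Suc[of w "p - 2"] by simp
    moreover from this have "w \<otimes>\<^bsub>Zp p\<^esub> w [^]\<^bsub>Zp p\<^esub> (p - 2) = \<one>\<^bsub>Zp p\<^esub>"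
      using w by (simp add: m_comm)
    ultimately show ?thesis
      using w by (auto simp: Units_def)
  qed
  have "teichmuller p x [^]\<^bsub>Zp p\<^esub> (x0 ^ n) \<otimes>\<^bsub>Zp p\<^esub>
       Zp_powr p (one_unit_part p x) (x [^]\<^bsub>Zp p\<^esub> n) = x \<longleftrightarrow>
      x \<in> Zp_roots_of_unity p \<and> x [^]\<^bsub>Zp p\<^esub> (x0 ^ n) = x"
    if x: "x \<in> carrier (Zp p)" "x 1 \<noteq> 0" for x and x0 :: nat
  proof
    assume R: "x \<in> Zp_roots_of_unity p \<and> x [^]\<^bsub>Zp p\<^esub> (x0 ^ n) = x"
    then have "teichmuller p x = x" using teichmuller_eq_iff[OF p(1) x] by blast
    moreover from this have "one_unit_part p x = \<one>\<^bsub>Zp p\<^esub>"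
      using R root_unit by (simp add: one_unit_part_def)
    ultimately show "teichmuller p x [^]\<^bsub>Zp p\<^esub> (x0 ^ n) \<otimes>\<^bsub>Zp p\<^esub>
       Zp_powr p (one_unit_part p x) (x [^]\<^bsub>Zp p\<^esub> n) = x"
      using R x Zp_powr_one_left[OF p] by simp
  next
    define w where "w = teichmuller p x"
    define u where "u = one_unit_part p x"
    define z where "z = x [^]\<^bsub>Zp p\<^esub> n"
    define E where "E = Zp_powr p u z"
    assume "teichmuller p x [^]\<^bsub>Zp p\<^esub> (x0 ^ n) \<otimes>\<^bsub>Zp p\<^esub>
       Zp_powr p (one_unit_part p x) (x [^]\<^bsub>Zp p\<^esub> n) = x"
    then have eq: "w [^]\<^bsub>Zp p\<^esub> (x0 ^ n) \<otimes>\<^bsub>Zp p\<^esub> E = x"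
      by (simp add: w_def u_def z_def E_def)
    have w: "w \<in> Zp_roots_of_unity p" "w 1 = x 1"
      using teichmuller_eq_iff[OF p(1) x, of w] by (simp_all add: w_def)
    have wU: "w \<in> Units (Zp p)" using w(1) by (rule root_unit)
    have wc: "w \<in> carrier (Zp p)" using wU by (rule Units_closed)
    have u: "u \<in> carrier (Zp p)"
      using x wU by (simp add: u_def one_unit_part_def w_def[symmetric])
    have xwu: "x = w \<otimes>\<^bsub>Zp p\<^esub> u"
      using x wU wc by (simp add: u_def one_unit_part_def w_def[symmetric] m_lcomm[of w x])
    have "coprime (x 1) (int p)"
      using x Zp_carrier_mod_self[OF x(1), of 1] p(1)
      by (metis coprime_commute dvd_imp_mod_0 power_one_right prime_imp_coprime prime_int_nat_transfer prime_nat_int_transfer)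
    moreover have "[x 1 * u 1 = x 1 * 1] (mod int p)"
    proof -
      have "x 1 = w 1 * u 1 mod int p ^ 1"
        using fun_cong[OF xwu, of 1] unfolding Zp_mult_apply .
      then have "x 1 * u 1 mod int p = x 1" by (simp only: w(2) power_one_right)
      then show ?thesis by (metis cong_mod_left cong_refl mult.right_neutral)
    qed
    ultimately have "[u 1 = 1] (mod int p)"
      using cong_mult_lcancel[of "x 1" "int p" "u 1" 1] by blast
    then have u1: "u 1 = 1"
      using Zp_carrier_mod_self[OF u, of 1] p1 by (simp add: cong_def)
    have z: "z \<in> carrier (Zp p)" using x by (simp add: z_def)
    have E: "E \<in> carrier (Zp p)" "E 1 = 1"
      unfolding E_def using Zp_powr_one_unit[OF p u u1 z] by blast+
    have ww: "w [^]\<^bsub>Zp p\<^esub> (x0 ^ n) \<in> Zp_roots_of_unity p"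
      by (rule Zp_roots_of_unity_pow[OF p(1) w(1)])
    have "(w [^]\<^bsub>Zp p\<^esub> (x0 ^ n)) 1 = w 1"
      using fun_cong[OF eq, of 1] Zp_carrier_mod_prime[of "w [^]\<^bsub>Zp p\<^esub> (x0 ^ n)" p] ww E w(2)
      unfolding Zp_mult_apply by (simp add: Zp_roots_of_unity_def)
    then have w_eq: "w [^]\<^bsub>Zp p\<^esub> (x0 ^ n) = w"
      by (rule Zp_roots_of_unity_eqI[OF p(1) ww w(1)])
    then have "w \<otimes>\<^bsub>Zp p\<^esub> E = w \<otimes>\<^bsub>Zp p\<^esub> u"
      using eq xwu by simp
    then have "E = u"
      using wU E u by (simp add: Units_l_cancel)
    then have "u = \<one>\<^bsub>Zp p\<^esub> \<or> z = \<one>\<^bsub>Zp p\<^esub>"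
      unfolding E_def by (rule Zp_powr_eq_base_imp[OF p u u1 z])
    then have "u = \<one>\<^bsub>Zp p\<^esub>"
    proof
      assume z1: "z = \<one>\<^bsub>Zp p\<^esub>"
      have wn: "w [^]\<^bsub>Zp p\<^esub> n \<in> Zp_roots_of_unity p"
        by (rule Zp_roots_of_unity_pow[OF p(1) w(1)])
      have prod: "w [^]\<^bsub>Zp p\<^esub> n \<otimes>\<^bsub>Zp p\<^esub> u [^]\<^bsub>Zp p\<^esub> n = \<one>\<^bsub>Zp p\<^esub>"
        using z1 wc u by (simp add: z_def xwu nat_pow_distrib)
      have "(u [^]\<^bsub>Zp p\<^esub> n) 1 = 1"
        using u1 p1 by (simp add: Zp_pow_apply)
      then have "(w [^]\<^bsub>Zp p\<^esub> n) 1 = 1"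
        using fun_cong[OF prod, of 1] Zp_carrier_mod_prime[of "w [^]\<^bsub>Zp p\<^esub> n" p] wn one1
        unfolding Zp_mult_apply by (simp add: Zp_roots_of_unity_def)
      then have "w [^]\<^bsub>Zp p\<^esub> n = \<one>\<^bsub>Zp p\<^esub>"
        using one1 by (intro Zp_roots_of_unity_eqI[OF p(1) wn]) (simp_all add: Zp_roots_of_unity_def)
      then have un: "u [^]\<^bsub>Zp p\<^esub> n = \<one>\<^bsub>Zp p\<^esub>"
        using prod u by simp
      show "u = \<one>\<^bsub>Zp p\<^esub>"
      proof (rule Zp_eqI[OF u one_closed])
        fix m
        have "[u M ^ n = 1] (mod int p ^ M)" for M
          using fun_cong[OF un, of M] by (simp add: Zp_pow_apply Zp_one_apply cong_def)
        then have "[u m = 1] (mod int p ^ m)"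
          by (rule Zp_one_unit_power_eq_one[OF p u u1 n])
        then show "[u m = \<one>\<^bsub>Zp p\<^esub> m] (mod int p ^ m)"
          by (simp add: Zp_one_apply)
      qed
    qed
    then have "x = w" using xwu wc by simp
    then show "x \<in> Zp_roots_of_unity p \<and> x [^]\<^bsub>Zp p\<^esub> (x0 ^ n) = x"
      using w(1) w_eq by simp
  qed
  moreover have "\<not> Zp_of_nat p p divides\<^bsub>Zp p\<^esub> x \<longleftrightarrow> x 1 \<noteq> 0" if "x \<in> carrier (Zp p)" for x
    using Zp_prime_divides_iff[OF p(1) that] by blast
  ultimately show ?thesis
    unfolding Zp_solutions_def using Zp_root_of_unity_residue[OF p(1)] by (auto simp: Zp_roots_of_unity_def)
qed

text \<open>Reduction modulo \<open>p\<close> is a bijection from the roots of unity to the nonzero residues, so that the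
  count takes place in the group of units modulo \<open>p\<close>.\<close>

lemma card_Zp_roots_of_unity_fixed:
  assumes p: "prime p" and K: "K > 0"
  defines "F \<equiv> {x \<in> Zp_roots_of_unity p. x [^]\<^bsub>Zp p\<^esub> K = x}"
  shows "finite F" and "card F = gcd (p - 1) (K - 1)"
proof -
  interpret cring "Zp p" using p by (simp add: Zp_cring prime_gt_0_nat)
  have p0: "p > 0" and p1: "p > 1" using prime_gt_1_nat[OF p] by simp_all
  define R where "R = {a \<in> {1..p - 1}. [a ^ (K - 1) = 1] (mod p)}"
  have bound: "0 \<le> x 1 \<and> x 1 < int p" if "x \<in> carrier (Zp p)" for x
    using that by (auto simp: Zp_def dest: spec[of _ 1])
  have fixed_iff: "x [^]\<^bsub>Zp p\<^esub> K = x \<longleftrightarrow> [x 1 ^ (K - 1) = 1] (mod int p)"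
    if x: "x \<in> Zp_roots_of_unity p" "x 1 \<noteq> 0" for x
  proof -
    have xc: "x \<in> carrier (Zp p)" using x by (simp add: Zp_roots_of_unity_def)
    have cop: "coprime (x 1) (int p)"
      using x xc bound[OF xc] p by (metis coprime_commute prime_imp_coprime prime_nat_int_transfer zdvd_not_zless order_le_less)
    have "x [^]\<^bsub>Zp p\<^esub> K = x \<longleftrightarrow> (x [^]\<^bsub>Zp p\<^esub> K) 1 = x 1"
      using Zp_roots_of_unity_eqI[OF p Zp_roots_of_unity_pow[OF p x(1)] x(1)] by auto
    also have "\<dots> \<longleftrightarrow> [x 1 ^ K = x 1] (mod int p)"
      using Zp_carrier_mod_self[OF xc, of 1] by (simp add: Zp_pow_apply cong_def)
    also have "x 1 ^ K = x 1 * x 1 ^ (K - 1)"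
      using K by (cases K) simp_all
    also have "[x 1 * x 1 ^ (K - 1) = x 1] (mod int p) \<longleftrightarrow> [x 1 ^ (K - 1) = 1] (mod int p)"
      using cong_mult_lcancel[OF cop, of "x 1 ^ (K - 1)" 1] by simp
    finally show ?thesis .
  qed
  have to_nat: "[int a ^ (K - 1) = 1] (mod int p) \<longleftrightarrow> [a ^ (K - 1) = 1] (mod p)" for a
    using cong_int_iff[of "a ^ (K - 1)" 1 p] by simp
  have bij: "bij_betw (\<lambda>x. nat (x 1)) F R"
  proof (rule bij_betw_imageI)
    show "inj_on (\<lambda>x. nat (x 1)) F"
    proof (rule inj_onI)
      fix x y assume xy: "x \<in> F" "y \<in> F" "nat (x 1) = nat (y 1)"
      then have "x \<in> Zp_roots_of_unity p" "y \<in> Zp_roots_of_unity p" by (auto simp: F_def)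
      moreover from this have "0 \<le> x 1" "0 \<le> y 1"
        using bound[of x] bound[of y] by (simp_all add: Zp_roots_of_unity_def)
      then have "x 1 = y 1"
        using xy(3) by (simp only: eq_nat_nat_iff)
      ultimately show "x = y" by (intro Zp_roots_of_unity_eqI[OF p])
    qed
    show "(\<lambda>x. nat (x 1)) ` F = R"
    proof (intro equalityI subsetI)
      fix a assume "a \<in> (\<lambda>x. nat (x 1)) ` F"
      then obtain x where x: "x \<in> F" "a = nat (x 1)" by blast
      then have x': "x \<in> Zp_roots_of_unity p" "x \<in> carrier (Zp p)" by (auto simp: F_def Zp_roots_of_unity_def)
      then have a: "x 1 = int a" "a \<ge> 1" "a < p"
        using x(2) bound[of x] Zp_root_of_unity_residue[OF p, of x] by auto
      have "[x 1 ^ (K - 1) = 1] (mod int p)"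
        using x(1) fixed_iff[OF x'(1) Zp_root_of_unity_residue[OF p x'(1)]] by (simp add: F_def)
      then show "a \<in> R"
        using a to_nat by (auto simp: R_def)
    next
      fix a assume a: "a \<in> R"
      then have a': "a \<ge> 1" "a < p" "int a mod int p = int a" using p1 by (auto simp: R_def)
      have "Zp_of_nat p a \<in> carrier (Zp p)" unfolding Zp_of_nat_def by simp
      moreover have a1: "Zp_of_nat p a 1 = int a" using a' by (simp add: Zp_of_nat_apply)
      ultimately obtain w where w: "w \<in> Zp_roots_of_unity p" "w 1 = int a"
        using Zp_root_of_unity_exists[OF p, of "Zp_of_nat p a"] a' by auto
      then have "w \<in> F"
        using fixed_iff[OF w(1) Zp_root_of_unity_residue[OF p w(1)]] to_nat a by (simp add: F_def R_def)
      then show "a \<in> (\<lambda>x. nat (x 1)) ` F"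
        using w(2) by force
    qed
  qed
  show "finite F" using bij_betw_finite[OF bij] by (simp add: R_def)
  show "card F = gcd (p - 1) (K - 1)"
    using bij_betw_same_card[OF bij] card_roots_of_unity_mod_prime[OF p, of "K - 1"] by (simp add: R_def)
qed

lemma card_Zp_solutions:
  assumes p: "prime p" "p \<noteq> 2" and n: "n > 0"
  shows "finite (Zp_solutions p n)"
    and "card (Zp_solutions p n) = (\<Sum>x0 = 1..p - 1. gcd (p - 1) (x0 ^ n - 1))"
proof -
  define F where "F x0 = {x \<in> Zp_roots_of_unity p. x [^]\<^bsub>Zp p\<^esub> (x0 ^ n) = x}" for x0 :: nat
  have F: "finite (F x0)" "card (F x0) = gcd (p - 1) (x0 ^ n - 1)" if "x0 \<in> {1..p - 1}" for x0
    unfolding F_def using that card_Zp_roots_of_unity_fixed[OF p(1), of "x0 ^ n"] by auto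
  have eq: "Zp_solutions p n = prod.swap ` (SIGMA x0:{1..p - 1}. F x0)"
    unfolding Zp_solutions_eq[OF assms] F_def by (auto simp: image_iff)
  show "finite (Zp_solutions p n)"
    unfolding eq using F by (intro finite_imageI finite_SigmaI) auto
  have "card (Zp_solutions p n) = card (SIGMA x0:{1..p - 1}. F x0)"
    unfolding eq by (rule card_image) simp
  also have "\<dots> = (\<Sum>x0 = 1..p - 1. card (F x0))"
    using F by (intro card_SigmaI) auto
  finally show "card (Zp_solutions p n) = (\<Sum>x0 = 1..p - 1. gcd (p - 1) (x0 ^ n - 1))"
    using F by simp
qed

section \<open>The solution counts\<close>

theorem theorem9:
  fixes p n e :: nat
  assumes "prime p" and "p \<noteq> 2" and "n > 0" and "p dvd n" and "e \<ge> 1"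
  shows
    "(e \<le> multiplicity p n \<longrightarrow>
        num_sols p n e =
          (\<Sum>x0 = 1..p - 1. gcd (p - 1) (x0 ^ n - 1)) +
          (\<Sum>x0 = 1..p - 1. gcd (gcd (p - 1) n) (x0 ^ n - 1) * (p ^ (e - 1) - 1)) \<and>
        num_sols p n e =
          (\<Sum>d | d dvd p - 1. totient d * ((p - 1) div d) * N_roots n d) +
          (\<Sum>d | d dvd gcd n (p - 1).
             totient d * ((p - 1) div d) * N_roots n d * (p ^ (e - 1) - 1))) \<and>
     (e \<ge> multiplicity p n + 1 \<longrightarrow>
        num_sols p n e =
          (\<Sum>x0 = 1..p - 1. gcd (p - 1) (x0 ^ n - 1)) +
          (\<Sum>x0 = 1..p - 1. gcd (gcd (p - 1) n) (x0 ^ n - 1) *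
             (p ^ ((e + multiplicity p n) div 2) - 1)) \<and>
        num_sols p n e =
          (\<Sum>d | d dvd p - 1. totient d * ((p - 1) div d) * N_roots n d) +
          (\<Sum>d | d dvd gcd n (p - 1).
             totient d * ((p - 1) div d) * N_roots n d *
             (p ^ ((e + multiplicity p n) div 2) - 1))) \<and>
     finite (Zp_solutions p n) \<and>
     card (Zp_solutions p n) = (\<Sum>x0 = 1..p - 1. gcd (p - 1) (x0 ^ n - 1)) \<and>
     card (Zp_solutions p n) = (\<Sum>d | d dvd p - 1. totient d * ((p - 1) div d) * N_roots n d)"
proof (intro conjI impI)
  note p = assms(1,2)
  define c where "c = (\<Sum>x0 = 1..p - 1. gcd (p - 1) (x0 ^ n - 1))"
  define g where "g = (\<Sum>x0 = 1..p - 1. gcd (gcd (p - 1) n) (x0 ^ n - 1))"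
  define J where "J = max 1 ((e - multiplicity p n + 1) div 2)"
  have p1: "p - 1 > 0"
    using prime_gt_1_nat[OF p(1)] by simp
  have c: "c = (\<Sum>d | d dvd p - 1. totient d * ((p - 1) div d) * N_roots n d)"
    unfolding c_def using p1 by (intro sum_gcd_eq_sum_totient) simp_all
  have "g = (\<Sum>d | d dvd gcd (p - 1) n. totient d * ((p - 1) div d) * N_roots n d)"
    unfolding g_def using p1 by (intro sum_gcd_eq_sum_totient) simp_all
  then have g: "g = (\<Sum>d | d dvd gcd n (p - 1). totient d * ((p - 1) div d) * N_roots n d)"
    by (simp only: gcd.commute)
  have sols: "num_sols p n e = c + g * (p ^ (e - J) - 1)"
    using num_sols_eq[OF p assms(3,5)] unfolding c_def g_def J_def sum_distrib_right .
  {
    assume "e \<le> multiplicity p n"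
    then have J: "e - J = e - 1" by (simp add: J_def)
    show "num_sols p n e =
          (\<Sum>x0 = 1..p - 1. gcd (p - 1) (x0 ^ n - 1)) +
          (\<Sum>x0 = 1..p - 1. gcd (gcd (p - 1) n) (x0 ^ n - 1) * (p ^ (e - 1) - 1))"
      using sols unfolding J c_def g_def sum_distrib_right .
    show "num_sols p n e =
          (\<Sum>d | d dvd p - 1. totient d * ((p - 1) div d) * N_roots n d) +
          (\<Sum>d | d dvd gcd n (p - 1).
             totient d * ((p - 1) div d) * N_roots n d * (p ^ (e - 1) - 1))"
      using sols unfolding J c g sum_distrib_right .
  next
    assume "e \<ge> multiplicity p n + 1"
    then have J: "e - J = (e + multiplicity p n) div 2"
      unfolding J_def by linarith
    show "num_sols p n e =
          (\<Sum>x0 = 1..p - 1. gcd (p - 1) (x0 ^ n - 1)) +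
          (\<Sum>x0 = 1..p - 1. gcd (gcd (p - 1) n) (x0 ^ n - 1) *
             (p ^ ((e + multiplicity p n) div 2) - 1))"
      using sols unfolding J c_def g_def sum_distrib_right .
    show "num_sols p n e =
          (\<Sum>d | d dvd p - 1. totient d * ((p - 1) div d) * N_roots n d) +
          (\<Sum>d | d dvd gcd n (p - 1).
             totient d * ((p - 1) div d) * N_roots n d *
             (p ^ ((e + multiplicity p n) div 2) - 1))"
      using sols unfolding J c g sum_distrib_right .
  }
  show "finite (Zp_solutions p n)"
    "card (Zp_solutions p n) = (\<Sum>x0 = 1..p - 1. gcd (p - 1) (x0 ^ n - 1))"
    using card_Zp_solutions[OF p assms(3)] .
  then show "card (Zp_solutions p n) = (\<Sum>d | d dvd p - 1. totient d * ((p - 1) div d) * N_roots n d)"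
    using c unfolding c_def by simp
qed

end
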